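(* Let $m,n\in\mathbb N_0$, let $q\in\mathbb C$ with $0<|q|<1$, and let $\alpha,a\in\mathbb C\setminus\{0\}$ be such that $(-q\alpha a;q)_\infty\neq 0$ and $(qa/\alpha;q)_\infty\ne 0$. Then the continuous big $q^{-1}$-Hermite polynomials $\mathsf H_n[z;a|q]$ satisfy $$\sum_{k=-\infty}^\infty (1+q^{2k}\alpha^2)\,\mathsf H_m[q^k\alpha;a|q]\,\mathsf H_n[q^k\alpha;a|q]\,\frac{(\frac{\alpha}{a};q)_k}{(-q\alpha a;q)_k}\,q^{3\binom k2}(-q\alpha^3 a)^k=\frac{(q,-\alpha^2,-\frac{q}{\alpha^2};q)_\infty}{(-q\alpha a,\frac{qa}{\alpha};q)_\infty}\,\frac{q^{-\binom n2}(q;q)_n}{q^n}\,\delta_{m,n}.$$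
   Context: Notation: $\mathbb N_0=\{0,1,2,\dots\}$. For $n\in\mathbb N_0$, $(y;q)_n=\prod_{j=0}^{n-1}(1-yq^j)$, $(y;q)_\infty=\prod_{j\ge0}(1-yq^j)$; for negative indices, $(y;q)_{-j}=1/(yq^{-j};q)_j$ (so $1/(y;q)_{-j}=(yq^{-j};q)_j$), $j\in\mathbb N$. Products: $(y_1,\dots,y_r;q)_k=\prod_i(y_i;q)_k$, also for $k=\infty$. $\binom k2=k(k-1)/2$ for all $k\in\mathbb Z$. $\delta_{m,n}$ is the Kronecker delta. The continuous big $q^{-1}$-Hermite polynomials are polynomials of degree $n$ in $x=\frac12(z-z^{-1})$, defined by $\mathsf H_n[z;a|q]=i^{-n}H_n[iz;ia|q^{-1}]$, where $H_n$ is the continuous big $q$-Hermite polynomial in standard normalization, written as a function of $w$ with argument $\frac12(w+w^{-1})$. Explicitly, $$\mathsf H_n[z;a|q]=\Big(-\frac1a\Big)^n\sum_{k=0}^n\frac{(q^{-n},\frac za,-\frac1{az};q)_k}{(q;q)_k}\,q^{-2\binom k2}\,(-q^na^2)^k.$$ *)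

theory Defs
  imports "HOL-Analysis.Analysis"
begin

definition qpoch :: "complex \<Rightarrow> complex \<Rightarrow> nat \<Rightarrow> complex" where
  "qpoch y q n = (\<Prod>j<n. 1 - y * q ^ j)"

definition qpoch_inf :: "complex \<Rightarrow> complex \<Rightarrow> complex" where
  "qpoch_inf y q = (\<Prod>j. 1 - y * q ^ j)"

text \<open>
  Integer index. If \<open>(y q^{-j}; q)_j = 0\<close>, then \<open>(y; q)_{-j}\<close> has a pole and takes the
  value \<open>1 / 0 = 0\<close> here; hence \<open>1 / (y; q)_{-j} = (y q^{-j}; q)_j\<close> holds without exception.
\<close>

definition qpoch_int :: "complex \<Rightarrow> complex \<Rightarrow> int \<Rightarrow> complex" where
  "qpoch_int y q k =
     (if k \<ge> 0 then qpoch y q (nat k) else 1 / qpoch (y * q powi k) q (nat (- k)))"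

lemma inverse_qpoch_int_neg:
  "1 / qpoch_int y q (- int j) = qpoch (y * q powi (- int j)) q j"
  by (cases "j = 0") (auto simp: qpoch_int_def qpoch_def)

text \<open>
  The continuous big \<open>q\<close>-Hermite polynomial in standard normalization,
  \<open>H_n(x; a | q) = a^{-n} 3\<phi>2(q^{-n}, a w, a / w; 0, 0; q, q)\<close> with \<open>x = (w + 1 / w) / 2\<close>,
  as a function of \<open>w\<close>.
\<close>

definition big_qHermite :: "nat \<Rightarrow> complex \<Rightarrow> complex \<Rightarrow> complex \<Rightarrow> complex" where
  "big_qHermite n w a q =
     (1 / a) ^ n *
     (\<Sum>k\<le>n. qpoch (q powi (- int n)) q k * qpoch (a * w) q k * qpoch (a / w) q k
               / qpoch q q k * q ^ k)"

text \<open>The continuous big \<open>q^{-1}\<close>-Hermite polynomial, with \<open>x = (z - 1 / z) / 2\<close>.\<close>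

definition big_qinv_Hermite :: "nat \<Rightarrow> complex \<Rightarrow> complex \<Rightarrow> complex \<Rightarrow> complex" where
  "big_qinv_Hermite n z a q =
     \<i> powi (- int n) * big_qHermite n (\<i> * z) (\<i> * a) (1 / q)"

lemma qpoch_inverse_base:
  assumes "y \<noteq> 0" "q \<noteq> 0"
  shows "qpoch y (1 / q) k = qpoch (1 / y) q k * (- y) ^ k / q ^ (k choose 2)"
proof (induction k)
  case 0
  then show ?case by (simp add: qpoch_def binomial_eq_0)
next
  case (Suc k)
  have "Suc k choose 2 = (k choose 2) + k"
    by (simp add: numeral_2_eq_2)
  moreover have "1 - y * (1 / q) ^ k = (1 - 1 / y * q ^ k) * (- y) / q ^ k"
    using assms by (simp add: field_simps power_divide)
  ultimately show ?case
    using Suc.IH by (simp add: qpoch_def power_add)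
qed

lemma big_qinv_Hermite_explicit:
  assumes "q \<noteq> 0" "a \<noteq> 0" "z \<noteq> 0"
  shows "big_qinv_Hermite n z a q =
    (- 1 / a) ^ n *
    (\<Sum>k\<le>n. qpoch (q powi (- int n)) q k * qpoch (z / a) q k * qpoch (- 1 / (a * z)) q k
              / qpoch q q k * q powi (- 2 * int (k choose 2)) * (- (q ^ n) * a\<^sup>2) ^ k)"
proof -
  have "\<i> powi (- int n) * (1 / (\<i> * a)) ^ n = (1 / (\<i> * (\<i> * a))) ^ n"
    by (simp only: power_int_minus power_int_of_nat power_divide power_mult_distrib power_one)
       (simp only: divide_inverse inverse_mult_distrib mult_1_left)
  also have "1 / (\<i> * (\<i> * a)) = - 1 / a"
    by (simp flip: mult.assoc)
  finally have pre: "\<i> powi (- int n) * (1 / (\<i> * a)) ^ n = (- 1 / a) ^ n" .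
  have summand:
    "qpoch ((1 / q) powi (- int n)) (1 / q) k * qpoch (\<i> * a * (\<i> * z)) (1 / q) k
        * qpoch (\<i> * a / (\<i> * z)) (1 / q) k / qpoch (1 / q) (1 / q) k * (1 / q) ^ k
     = qpoch (q powi (- int n)) q k * qpoch (z / a) q k * qpoch (- 1 / (a * z)) q k
        / qpoch q q k * q powi (- 2 * int (k choose 2)) * (- (q ^ n) * a\<^sup>2) ^ k"
    (is "?L = ?R") for k
  proof -
    define c where "c = q ^ (k choose 2)"
    have c: "c \<noteq> 0" using assms by (simp add: c_def)
    have p1: "qpoch ((1 / q) powi (- int n)) (1 / q) k
        = qpoch (q powi (- int n)) q k * (- (q ^ n)) ^ k / c"
      using qpoch_inverse_base[of "q ^ n" q k] assms
      by (simp add: c_def power_int_minus divide_inverse power_inverse)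
    have ii: "\<i> * a * (\<i> * z) = - (a * z)"
      by (simp add: mult_ac)
    have p2: "qpoch (\<i> * a * (\<i> * z)) (1 / q) k = qpoch (- 1 / (a * z)) q k * (a * z) ^ k / c"
      using qpoch_inverse_base[of "- (a * z)" q k] assms by (simp add: ii c_def)
    have p3: "qpoch (\<i> * a / (\<i> * z)) (1 / q) k = qpoch (z / a) q k * (- (a / z)) ^ k / c"
      using qpoch_inverse_base[of "a / z" q k] assms by (simp add: c_def)
    have p4: "qpoch (1 / q) (1 / q) k = qpoch q q k * (- (1 / q)) ^ k / c"
      using qpoch_inverse_base[of "1 / q" q k] assms by (simp add: c_def)
    have "q powi (- 2 * int (k choose 2)) = q powi (- int (2 * (k choose 2)))"
      by simp
    also have "\<dots> = 1 / q ^ (2 * (k choose 2))"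
      by (simp only: power_int_minus power_int_of_nat inverse_eq_divide)
    also have "\<dots> = 1 / c\<^sup>2"
      by (simp add: c_def power_even_eq)
    finally have c2: "q powi (- 2 * int (k choose 2)) = 1 / c\<^sup>2" .
    have "(- (q ^ n)) ^ k * (a * z) ^ k * (- (a / z)) ^ k / (- (1 / q)) ^ k * (1 / q) ^ k
        = ((- (q ^ n)) * (a * z) * (- (a / z)) / (- (1 / q)) * (1 / q)) ^ k"
      by (simp only: power_mult_distrib power_divide)
    also have "(- (q ^ n)) * (a * z) * (- (a / z)) / (- (1 / q)) * (1 / q) = - (q ^ n) * a\<^sup>2"
      using assms by (simp add: field_simps power2_eq_square)
    finally have e: "(- (q ^ n)) ^ k * (a * z) ^ k * (- (a / z)) ^ k / (- (1 / q)) ^ k * (1 / q) ^ k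
        = (- (q ^ n) * a\<^sup>2) ^ k" .
    have "?L = qpoch (q powi (- int n)) q k * qpoch (z / a) q k * qpoch (- 1 / (a * z)) q k
        / qpoch q q k * (1 / c\<^sup>2) *
        ((- (q ^ n)) ^ k * (a * z) ^ k * (- (a / z)) ^ k / (- (1 / q)) ^ k * (1 / q) ^ k)"
      unfolding p1 p2 p3 p4 using c by (simp add: divide_inverse power2_eq_square mult_ac)
    then show ?thesis unfolding e c2 .
  qed
  show ?thesis
    unfolding big_qinv_Hermite_def big_qHermite_def summand
    by (simp only: pre flip: mult.assoc)
qed

end

theory Submission
  imports Defs
begin

text \<open>
  Write \<open>A = - \<alpha>\<^sup>2\<close> and \<open>t = a / \<alpha>\<close>. Multiplied by
  \<open>(- q \<alpha> a, q a / \<alpha>; q)\<^sub>\<infinity>\<close>, the weight at \<open>z = q\<^sup>k \<alpha>\<close> becomes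
  \<open>vwp_term A q t k = (1 - A q^{2k}) q^{k (2k - 1)} A^{2k} (A t q^{k + 1}, t q^{1 - k}; q)\<^sub>\<infinity>\<close>,
  which is entire in \<open>t\<close>. Three facts give the orthogonality.

  (1) Total mass (\<open>vwp_term_has_sum\<close>): the sum of \<open>vwp_term A q t\<close> over the integers is
  \<open>(q, A, q / A; q)\<^sub>\<infinity>\<close>, whatever \<open>t\<close> is; this is a limiting case of Bailey's \<open>6\<psi>6\<close>
  summation. The difference of the summands at \<open>t\<close> and \<open>t q\<close> telescopes, so the sum \<open>G(t)\<close>
  satisfies \<open>G(t) = G(t q^N)\<close>, and letting \<open>N\<close> tend to infinity \<open>G(t) = G(0)\<close>. At \<open>t = 1 / A\<close>
  the terms with negative \<open>k\<close> vanish, and what is left is Sylvester's series for \<open>(A; q)\<^sub>\<infinity>\<close>,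
  which is again summed by telescoping in \<open>A\<close> to \<open>A q\<close> and a limit. The Jacobi triple product
  is the value at \<open>t = 0\<close>; it comes out as a by-product.

  (2) Integrals of single polynomials (\<open>has_sum_vwp_term_big_qinv_Hermite\<close>): multiplying the
  weight by \<open>(z / a, - 1 / (a z); q)\<^sub>j\<close> replaces \<open>t\<close> by \<open>t / q^j\<close>, up to a factor free of \<open>k\<close>.
  Since the total mass does not depend on \<open>t\<close>, integrating the \<open>n\<close>-th polynomial leaves a
  terminating \<open>1\<phi>0\<close> sum, which vanishes for \<open>n > 0\<close>. This is where working with
  the entire function pays: the shifted parameter \<open>a / q^j\<close> may violate the nonvanishing
  hypotheses that \<open>a\<close> satisfies.

  (3) The three-term recurrence (\<open>big_qinv_Hermite_recurrence\<close>). For any sequence satisfying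
  such a recurrence, the vanishing in (2) already implies orthogonality, and the squared norms
  are products of recurrence coefficients (\<open>has_sum_orthogonal_three_term\<close>).
\<close>

section \<open>Finite and infinite q-shifted factorials\<close>

lemma qpoch_0 [simp]: "qpoch y q 0 = 1"
  by (simp add: qpoch_def)

lemma qpoch_Suc: "qpoch y q (Suc n) = qpoch y q n * (1 - y * q ^ n)"
  by (simp add: qpoch_def)

lemma qpoch_Suc_shift: "qpoch y q (Suc n) = (1 - y) * qpoch (y * q) q n"
  unfolding qpoch_def prod.lessThan_Suc_shift by (simp add: mult_ac)

lemma qpoch_add: "qpoch y q (m + n) = qpoch y q m * qpoch (y * q ^ m) q n"
  by (induction n) (simp_all add: qpoch_Suc power_add mult_ac)

lemma qpoch_eq_0_iff: "qpoch y q n = 0 \<longleftrightarrow> (\<exists>j<n. y * q ^ j = 1)"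
  by (auto simp: qpoch_def)

text \<open>
  The bound is uniform in \<open>n\<close>, so it passes to the infinite product; it gives both boundedness
  and the limit 1 as \<open>y\<close> tends to 0.
\<close>

lemma norm_qpoch_minus1_le:
  assumes "norm q < 1"
  shows "norm (qpoch y q n - 1) \<le> exp (norm y / (1 - norm q)) - 1"
proof -
  have "norm ((\<Prod>j<n. 1 + - (y * q ^ j)) - 1) \<le> (\<Prod>j<n. 1 + norm (- (y * q ^ j))) - 1"
    by (rule norm_prod_minus1_le_prod_minus1)
  also have "(\<Prod>j<n. 1 + norm (- (y * q ^ j))) \<le> (\<Prod>j<n. exp (norm y * norm q ^ j))"
    by (intro prod_mono conjI) (auto simp: norm_mult norm_power add_nonneg_nonneg)
  also have "\<dots> = exp (norm y * (\<Sum>j<n. norm q ^ j))"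
    by (simp add: exp_sum sum_distrib_left)
  also have "(\<Sum>j<n. norm q ^ j) \<le> (\<Sum>j. norm q ^ j)"
    using assms by (intro sum_le_suminf summable_geometric) auto
  also have "\<dots> = 1 / (1 - norm q)"
    using assms by (intro suminf_geometric) auto
  finally show ?thesis
    by (simp add: qpoch_def mult_left_mono)
qed

lemma norm_qpoch_le:
  assumes "norm q < 1"
  shows "norm (qpoch y q n) \<le> exp (norm y / (1 - norm q))"
  using norm_qpoch_minus1_le[OF assms, of y n] norm_triangle_ineq2[of "qpoch y q n" 1] by simp

lemma qpoch_LIMSEQ:
  assumes "norm q < 1"
  shows "qpoch y q \<longlonglongrightarrow> qpoch_inf y q"
proof -
  have "summable (\<lambda>j. norm y * norm q ^ j)"
    using assms by (intro summable_mult summable_geometric) auto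
  then have "convergent_prod (\<lambda>j. 1 - y * q ^ j)"
    by (intro abs_convergent_prod_imp_convergent_prod summable_imp_abs_convergent_prod)
       (simp add: norm_mult norm_power)
  then have "(\<lambda>n. qpoch y q (Suc n)) \<longlonglongrightarrow> qpoch_inf y q"
    unfolding qpoch_def qpoch_inf_def lessThan_Suc_atMost by (rule convergent_prod_LIMSEQ)
  then show ?thesis
    by (rule LIMSEQ_imp_Suc)
qed

lemma qpoch_inf_split:
  assumes "norm q < 1"
  shows "qpoch_inf y q = qpoch y q n * qpoch_inf (y * q ^ n) q"
proof (rule LIMSEQ_unique)
  show "(\<lambda>m. qpoch y q (n + m)) \<longlonglongrightarrow> qpoch_inf y q"
    using LIMSEQ_ignore_initial_segment[OF qpoch_LIMSEQ[OF assms], of y n] by (simp add: add.commute)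
  show "(\<lambda>m. qpoch y q (n + m)) \<longlonglongrightarrow> qpoch y q n * qpoch_inf (y * q ^ n) q"
    unfolding qpoch_add by (intro tendsto_intros qpoch_LIMSEQ assms)
qed

lemma qpoch_inf_Suc:
  assumes "norm q < 1"
  shows "qpoch_inf y q = (1 - y) * qpoch_inf (y * q) q"
  using qpoch_inf_split[OF assms, of y 1] by (simp add: qpoch_Suc)

lemma qpoch_inf_eq_0:
  assumes "norm q < 1" "y * q ^ n = 1"
  shows "qpoch_inf y q = 0"
  using qpoch_inf_split[OF assms(1), of y "Suc n"] assms by (simp add: qpoch_Suc)

lemma norm_qpoch_inf_minus1_le:
  assumes "norm q < 1"
  shows "norm (qpoch_inf y q - 1) \<le> exp (norm y / (1 - norm q)) - 1"
  by (rule tendsto_upperbound[OF tendsto_norm[OF tendsto_diff[OF qpoch_LIMSEQ tendsto_const]]])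
     (use assms norm_qpoch_minus1_le in auto)

lemma norm_qpoch_inf_le:
  assumes "norm q < 1"
  shows "norm (qpoch_inf y q) \<le> exp (norm y / (1 - norm q))"
  using norm_qpoch_inf_minus1_le[OF assms, of y] norm_triangle_ineq2[of "qpoch_inf y q" 1] by simp

lemma tendsto_qpoch_inf_1:
  assumes "norm q < 1" "y \<longlonglongrightarrow> 0"
  shows "(\<lambda>N. qpoch_inf (y N) q) \<longlonglongrightarrow> 1"
proof -
  have "(\<lambda>N. exp (norm (y N) / (1 - norm q)) - 1) \<longlonglongrightarrow> exp (norm (0::complex) / (1 - norm q)) - 1"
    using assms by (intro tendsto_intros) auto
  then have "(\<lambda>N. exp (norm (y N) / (1 - norm q)) - 1) \<longlonglongrightarrow> 0"
    by simp
  then have "(\<lambda>N. qpoch_inf (y N) q - 1) \<longlonglongrightarrow> 0"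
    by (rule Lim_null_comparison[OF always_eventually, rotated])
       (use norm_qpoch_inf_minus1_le[OF assms(1)] in auto)
  then show ?thesis
    by (simp add: LIM_zero_iff)
qed

text \<open>
  Each factor \<open>1 - q^i / y\<close> equals \<open>(- q^i / y) (1 - y q^{-i})\<close>, and the factors
  \<open>1 - y q^{-i}\<close> prolong the infinite product to the left.
\<close>

lemma qpoch_inf_reflect:
  assumes "norm q < 1" "q \<noteq> 0" "y \<noteq> 0"
  shows "qpoch (1 / y) q j * qpoch_inf (y * q) q
       = (- 1 / y) ^ j * q ^ (j choose 2) * qpoch_inf (y * q powi (1 - int j)) q"
proof (induction j)
  case 0
  then show ?case by (simp add: binomial_eq_0)
next
  case (Suc j)
  have "qpoch_inf (y * q powi (1 - int (Suc j))) q
      = (1 - y * q powi (- int j)) * qpoch_inf (y * q powi (1 - int j)) q"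
    using assms by (subst qpoch_inf_Suc) (auto simp: power_int_diff power_int_minus field_simps)
  moreover have "(1 - 1 / y * q ^ j) = (- 1 / y) * q ^ j * (1 - y * q powi (- int j))"
    using assms by (simp add: power_int_minus field_simps)
  moreover have "Suc j choose 2 = (j choose 2) + j"
    by (simp add: numeral_2_eq_2)
  ultimately show ?case
    using Suc.IH by (simp add: qpoch_Suc power_add)
qed

section \<open>Gaussian domination of bilateral series\<close>

text \<open>
  Every series below is dominated by \<open>C D^{|k|} r^{c k\<^sup>2}\<close> with \<open>r = |q|\<close> and \<open>c > 0\<close>. Recording
  only the Gaussian rate \<open>c\<close> makes the estimates compositional: rates add under products,
  \<open>q^{e(k)}\<close> with a quadratic exponent contributes its leading coefficient, exponential factors
  contribute 0, and each \<open>(y q^k; q)\<^sub>\<infinity>\<close> costs \<open>1 / 2\<close>. The extra index \<open>N\<close> makes the bound uniform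
  along a sequence of series, as dominated convergence requires.
\<close>

definition gauss_dom :: "real \<Rightarrow> real \<Rightarrow> (nat \<Rightarrow> int \<Rightarrow> complex) \<Rightarrow> bool" where
  "gauss_dom r c f \<longleftrightarrow>
     (\<exists>C D. C \<ge> 0 \<and> D \<ge> 1 \<and>
        (\<forall>N k. norm (f N k) \<le> C * D ^ nat \<bar>k\<bar> * r powr (c * (real_of_int k)\<^sup>2)))"

lemma gauss_domI:
  assumes "C \<ge> 0" "D \<ge> 1"
    "\<And>N k. norm (f N k) \<le> C * D ^ nat \<bar>k\<bar> * r powr (c * (real_of_int k)\<^sup>2)"
  shows "gauss_dom r c f"
  using assms unfolding gauss_dom_def by blast

lemma gauss_dom_mult:
  assumes "gauss_dom r c f" "gauss_dom r d g"
  shows "gauss_dom r (c + d) (\<lambda>N k. f N k * g N k)"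
proof -
  obtain C D where 1: "C \<ge> 0" "D \<ge> 1"
    "\<And>N k. norm (f N k) \<le> C * D ^ nat \<bar>k\<bar> * r powr (c * (real_of_int k)\<^sup>2)"
    using assms(1) unfolding gauss_dom_def by blast
  obtain C' D' where 2: "C' \<ge> 0" "D' \<ge> 1"
    "\<And>N k. norm (g N k) \<le> C' * D' ^ nat \<bar>k\<bar> * r powr (d * (real_of_int k)\<^sup>2)"
    using assms(2) unfolding gauss_dom_def by blast
  show ?thesis
  proof (rule gauss_domI[of "C * C'" "D * D'"])
    show "1 \<le> D * D'"
      using mult_mono[OF 1(2) 2(2)] 1(2) by simp
    fix N k
    have "norm (f N k * g N k) \<le> (C * D ^ nat \<bar>k\<bar> * r powr (c * (real_of_int k)\<^sup>2))
        * (C' * D' ^ nat \<bar>k\<bar> * r powr (d * (real_of_int k)\<^sup>2))"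
      unfolding norm_mult using 1 2 by (intro mult_mono) auto
    also have "\<dots> = C * C' * (D * D') ^ nat \<bar>k\<bar> * r powr ((c + d) * (real_of_int k)\<^sup>2)"
      by (simp add: powr_add power_mult_distrib distrib_right mult_ac)
    finally show "norm (f N k * g N k) \<le> \<dots>" .
  qed (use 1 2 in auto)
qed

lemma gauss_dom_diff:
  assumes "gauss_dom r c f" "gauss_dom r c g"
  shows "gauss_dom r c (\<lambda>N k. f N k - g N k)"
proof -
  obtain C D where 1: "C \<ge> 0" "D \<ge> 1"
    "\<And>N k. norm (f N k) \<le> C * D ^ nat \<bar>k\<bar> * r powr (c * (real_of_int k)\<^sup>2)"
    using assms(1) unfolding gauss_dom_def by blast
  obtain C' D' where 2: "C' \<ge> 0" "D' \<ge> 1"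
    "\<And>N k. norm (g N k) \<le> C' * D' ^ nat \<bar>k\<bar> * r powr (c * (real_of_int k)\<^sup>2)"
    using assms(2) unfolding gauss_dom_def by blast
  show ?thesis
  proof (rule gauss_domI[of "C + C'" "max D D'"])
    fix N k
    have "norm (f N k - g N k) \<le> C * D ^ nat \<bar>k\<bar> * r powr (c * (real_of_int k)\<^sup>2)
        + C' * D' ^ nat \<bar>k\<bar> * r powr (c * (real_of_int k)\<^sup>2)"
      using norm_triangle_ineq4[of "f N k" "g N k"] 1(3)[of N k] 2(3)[of N k] by linarith
    also have "\<dots> \<le> C * max D D' ^ nat \<bar>k\<bar> * r powr (c * (real_of_int k)\<^sup>2)
        + C' * max D D' ^ nat \<bar>k\<bar> * r powr (c * (real_of_int k)\<^sup>2)"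
      using 1(1,2) 2(1,2)
      by (intro add_mono mult_right_mono mult_left_mono power_mono) auto
    finally show "norm (f N k - g N k)
        \<le> (C + C') * max D D' ^ nat \<bar>k\<bar> * r powr (c * (real_of_int k)\<^sup>2)"
      by (simp add: distrib_right)
  qed (use 1 2 in auto)
qed

lemma gauss_dom_exponential:
  assumes "r > 0" "\<And>N k. norm (f N k) \<le> C * D ^ nat \<bar>k\<bar>"
  shows "gauss_dom r 0 f"
proof (rule gauss_domI[of "\<bar>C\<bar>" "max 1 \<bar>D\<bar>"])
  fix N k
  have "C * D ^ nat \<bar>k\<bar> \<le> \<bar>C\<bar> * \<bar>D\<bar> ^ nat \<bar>k\<bar>"
    using abs_ge_self[of "C * D ^ nat \<bar>k\<bar>"] by (simp add: abs_mult power_abs)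
  also have "\<dots> \<le> \<bar>C\<bar> * max 1 \<bar>D\<bar> ^ nat \<bar>k\<bar>"
    by (intro mult_left_mono power_mono) auto
  finally show "norm (f N k)
      \<le> \<bar>C\<bar> * max 1 \<bar>D\<bar> ^ nat \<bar>k\<bar> * r powr (0 * (real_of_int k)\<^sup>2)"
    using assms(2)[of N k] \<open>r > 0\<close> by simp
qed auto

lemma gauss_dom_bounded:
  assumes "r > 0" "\<And>N k. norm (f N k) \<le> B"
  shows "gauss_dom r 0 f"
  by (rule gauss_dom_exponential[of _ _ B 1]) (use assms in auto)

lemma norm_power_int_le:
  fixes y :: complex
  assumes "y \<noteq> 0"
  shows "norm (y powi k) \<le> (norm y + 1 / norm y) ^ nat \<bar>k\<bar>"
proof (cases "k \<ge> 0")
  case True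
  then show ?thesis
    by (simp add: power_int_def norm_power power_mono)
next
  case False
  have "norm (y powi k) = (1 / norm y) ^ nat \<bar>k\<bar>"
    using False by (simp add: power_int_def norm_power norm_inverse norm_divide inverse_eq_divide power_one_over)
  also have "\<dots> \<le> (norm y + 1 / norm y) ^ nat \<bar>k\<bar>"
    by (intro power_mono) auto
  finally show ?thesis .
qed

lemma gauss_dom_powi:
  assumes "r > 0" "y \<noteq> 0"
  shows "gauss_dom r 0 (\<lambda>N k. y powi k)"
  by (rule gauss_dom_exponential[of _ _ 1 "norm y + 1 / norm y"])
     (use assms norm_power_int_le in auto)

lemma gauss_dom_quadratic_powi:
  assumes "q \<noteq> 0" "norm q < 1"
    "\<And>k. real_of_int (e k) = c * (real_of_int k)\<^sup>2 + d * real_of_int k"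
  shows "gauss_dom (norm q) c (\<lambda>N k. q powi (e k))"
proof (rule gauss_domI[of 1 "norm q powr (- \<bar>d\<bar>)"])
  show "1 \<le> norm q powr - \<bar>d\<bar>"
    using assms powr_mono'[of "- \<bar>d\<bar>" 0 "norm q"] by simp
  fix N :: nat and k
  have "norm (q powi (e k)) = norm q powr (d * real_of_int k) * norm q powr (c * (real_of_int k)\<^sup>2)"
    using assms by (simp add: norm_power_int add.commute flip: powr_real_of_int' powr_add)
  also have "norm q powr (d * real_of_int k) \<le> norm q powr (- \<bar>d\<bar> * real (nat \<bar>k\<bar>))"
  proof (rule powr_mono')
    have "- (d * real_of_int k) \<le> \<bar>d\<bar> * \<bar>real_of_int k\<bar>"
      by (metis abs_ge_minus_self abs_mult)
    then show "- \<bar>d\<bar> * real (nat \<bar>k\<bar>) \<le> d * real_of_int k"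
      by simp
  qed (use assms in auto)
  also have "\<dots> = (norm q powr (- \<bar>d\<bar>)) ^ nat \<bar>k\<bar>"
    using assms by (simp add: powr_powr flip: powr_realpow)
  finally show "norm (q powi (e k))
      \<le> 1 * (norm q powr (- \<bar>d\<bar>)) ^ nat \<bar>k\<bar> * norm q powr (c * (real_of_int k)\<^sup>2)"
    by (simp add: mult_right_mono)
qed auto

text \<open>
  Shifting \<open>y\<close> to \<open>y q^{-j}\<close> inserts the factors \<open>1 - y q^{-i}\<close> for \<open>i = 1, \<dots>, j\<close>, each of
  size at most \<open>(1 + |y|) |q|^{-i}\<close>.
\<close>

lemma norm_qpoch_inf_powi_neg_le:
  assumes "q \<noteq> 0" "norm q < 1" "norm y \<le> B"
  shows "norm (qpoch_inf (y * q powi (- int j)) q)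
    \<le> exp (B / (1 - norm q)) * (1 + B) ^ j * norm q powr (- (real j * (real j + 1) / 2))"
proof (induction j)
  case 0
  have "norm (qpoch_inf y q) \<le> exp (norm y / (1 - norm q))"
    using assms by (intro norm_qpoch_inf_le)
  also have "\<dots> \<le> exp (B / (1 - norm q))"
    using assms by (simp add: divide_right_mono)
  finally show ?case using assms by simp
next
  case (Suc j)
  define s where "s = norm q powr (- (real j + 1))"
  have s: "s \<ge> 1"
    unfolding s_def using assms powr_mono'[of "- (real j + 1)" 0 "norm q"] by simp
  have "norm (q powi (- int (Suc j))) = s"
    using assms by (simp add: s_def norm_power_int add.commute flip: powr_real_of_int')
  then have "norm (1 - y * q powi (- int (Suc j))) \<le> 1 + norm y * s"
    using norm_triangle_ineq4[of 1 "y * q powi (- int (Suc j))"] by (simp add: norm_mult)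
  also have "\<dots> \<le> 1 + B * s"
    using assms s by (simp add: mult_right_mono)
  also have "\<dots> \<le> (1 + B) * s"
    using s by (simp add: distrib_right)
  finally have 1: "norm (1 - y * q powi (- int (Suc j))) \<le> (1 + B) * s" .
  have "qpoch_inf (y * q powi (- int (Suc j))) q
      = (1 - y * q powi (- int (Suc j))) * qpoch_inf (y * q powi (- int j)) q"
    using qpoch_inf_Suc[OF assms(2), of "y * q powi (- int (Suc j))"] assms
    by (simp add: power_int_minus power_int_diff field_simps)
  then have "norm (qpoch_inf (y * q powi (- int (Suc j))) q)
      \<le> ((1 + B) * s) * (exp (B / (1 - norm q)) * (1 + B) ^ j
           * norm q powr (- (real j * (real j + 1) / 2)))"
    using 1 Suc.IH order_trans[OF norm_ge_zero assms(3)] s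
    by (simp only: norm_mult) (intro mult_mono; simp)
  also have "\<dots> = exp (B / (1 - norm q)) * (1 + B) ^ Suc j
      * norm q powr (- (real j + 1) + - (real j * (real j + 1) / 2))"
    unfolding s_def powr_add by simp
  also have "- (real j + 1) + - (real j * (real j + 1) / 2)
      = - (real (Suc j) * (real (Suc j) + 1) / 2)"
    by (simp add: field_simps)
  finally show ?case .
qed

lemma gauss_dom_qpoch_inf:
  assumes "q \<noteq> 0" "norm q < 1" "\<And>N. norm (y N) \<le> B"
  shows "gauss_dom (norm q) (- 1 / 2) (\<lambda>N k. qpoch_inf (y N * q powi k) q)"
proof (rule gauss_domI[of "exp (B / (1 - norm q))" "(1 + B) * norm q powr (- 1 / 2)"])
  have B: "B \<ge> 0"
    using norm_ge_zero[of "y 0"] assms(3)[of 0] by linarith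
  have h: "norm q powr (- 1 / 2) \<ge> 1"
    using assms powr_mono'[of "- 1 / 2" 0 "norm q"] by simp
  show "1 \<le> (1 + B) * norm q powr (- 1 / 2)"
    using mult_mono[of 1 "1 + B" 1 "norm q powr (- 1 / 2)"] B h by simp
  fix N and k :: int
  define j where "j = nat \<bar>k\<bar>"
  have bd: "norm (qpoch_inf (y N * q powi k) q)
    \<le> exp (B / (1 - norm q)) * (1 + B) ^ j * norm q powr (- (real j * (real j + 1) / 2))"
  proof (cases "k \<le> 0")
    case True
    then have "k = - int j" by (simp add: j_def)
    then show ?thesis using norm_qpoch_inf_powi_neg_le[OF assms(1,2) assms(3)[of N], of j] by simp
  next
    case False
    have "norm (y N * q powi k) \<le> B * 1"
      unfolding norm_mult using False assms B
      by (intro mult_mono) (auto simp: power_int_def norm_power power_le_one)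
    then have "exp (norm (y N * q powi k) / (1 - norm q)) \<le> exp (B / (1 - norm q)) * 1"
      using assms by (simp add: divide_right_mono)
    moreover have "1 \<le> (1 + B) ^ j * norm q powr (- (real j * (real j + 1) / 2))"
      using mult_mono[of 1 "(1 + B) ^ j" 1 "norm q powr (- (real j * (real j + 1) / 2))"]
        powr_mono'[of "- (real j * (real j + 1) / 2)" 0 "norm q"] B assms by simp
    ultimately have "exp (norm (y N * q powi k) / (1 - norm q)) \<le> exp (B / (1 - norm q))
        * ((1 + B) ^ j * norm q powr (- (real j * (real j + 1) / 2)))"
      by (rule order_trans[OF _ mult_left_mono]) auto
    then show ?thesis
      using norm_qpoch_inf_le[OF assms(2), of "y N * q powi k"]
      by (simp add: mult.assoc)
  qed
  have sq: "(real j)\<^sup>2 = (real_of_int k)\<^sup>2"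
    by (simp add: j_def)
  have "norm q powr (- (real j * (real j + 1) / 2))
      = norm q powr (- 1 / 2 * real j) * norm q powr (- 1 / 2 * (real j)\<^sup>2)"
    unfolding powr_add[symmetric] by (rule arg_cong[where f = "\<lambda>u. norm q powr u"])
       (simp add: field_simps power2_eq_square)
  also have "norm q powr (- 1 / 2 * real j) = (norm q powr (- 1 / 2)) ^ j"
    using assms by (simp add: powr_powr flip: powr_realpow)
  finally show "norm (qpoch_inf (y N * q powi k) q) \<le> exp (B / (1 - norm q))
      * ((1 + B) * norm q powr (- 1 / 2)) ^ nat \<bar>k\<bar> * norm q powr (- 1 / 2 * (real_of_int k)\<^sup>2)"
    using bd by (simp add: power_mult_distrib sq mult_ac flip: j_def)
qed auto

lemma summable_on_int_if_abs:
  fixes f :: "nat \<Rightarrow> real"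
  assumes "summable f" "\<And>j. f j \<ge> 0"
  shows "(\<lambda>k::int. f (nat \<bar>k\<bar>)) summable_on UNIV"
proof -
  have f: "f summable_on UNIV"
    using assms by (intro norm_summable_imp_summable_on) simp
  have 1: "(\<lambda>k::int. f (nat \<bar>k\<bar>)) summable_on range int"
    using f by (subst summable_on_reindex) (auto simp: o_def)
  have "f summable_on range Suc"
    by (rule summable_on_subset_banach[OF f]) simp
  then have "(f \<circ> Suc) summable_on UNIV"
    by (subst (asm) summable_on_reindex) simp_all
  then have 2: "(\<lambda>k::int. f (nat \<bar>k\<bar>)) summable_on range (\<lambda>n. - int (Suc n))"
    by (subst summable_on_reindex) (auto simp: o_def inj_on_def nat_add_distrib)
  have "(UNIV :: int set) = range int \<union> range (\<lambda>n. - int (Suc n))"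
  proof (intro set_eqI iffI UNIV_I)
    fix k :: int
    show "k \<in> range int \<union> range (\<lambda>n. - int (Suc n))"
      by (cases k) auto
  qed
  moreover have "range int \<inter> range (\<lambda>n. - int (Suc n)) = {}"
    by auto
  ultimately show ?thesis
    using summable_on_Un_disjoint[OF 1 2] by simp
qed

lemma gauss_dom_majorant:
  assumes "0 < r" "r < 1" "c > 0" "gauss_dom r c f"
  obtains M where "M summable_on UNIV" "\<And>N k. norm (f N k) \<le> M k"
proof -
  obtain C D where C: "C \<ge> 0" "D \<ge> 1"
    and le: "\<And>N k. norm (f N k) \<le> C * D ^ nat \<bar>k\<bar> * r powr (c * (real_of_int k)\<^sup>2)"
    using assms(4) unfolding gauss_dom_def by blast
  define h where "h j = C * D ^ j * r powr (c * (real j)\<^sup>2)" for j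
  have "(\<lambda>j. D * r powr (c * real j)) \<longlonglongrightarrow> D * 0"
  proof (intro tendsto_intros)
    have "(\<lambda>j. (r powr c) ^ j) \<longlonglongrightarrow> 0"
      using assms by (intro LIMSEQ_power_zero) (simp add: powr01_less_one)
    then show "(\<lambda>j. r powr (c * real j)) \<longlonglongrightarrow> 0"
      using assms by (simp add: powr_power mult.commute)
  qed
  then have "eventually (\<lambda>j. D * r powr (c * real j) < 1 / 2) sequentially"
    by (rule order_tendstoD) auto
  then have "eventually (\<lambda>j. norm (h j) \<le> C * (1 / 2) ^ j) sequentially"
  proof eventually_elim
    case (elim j)
    have "h j = C * (D * r powr (c * real j)) ^ j"
      using assms by (simp add: h_def power_mult_distrib powr_power power2_eq_square mult_ac)
    also have "\<dots> \<le> C * (1 / 2) ^ j"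
      using elim C by (intro mult_left_mono power_mono) auto
    finally show ?case
      using C by (simp add: h_def)
  qed
  then have "summable h"
    by (rule summable_comparison_test_ev) (intro summable_mult summable_geometric; simp)
  then have "(\<lambda>k::int. h (nat \<bar>k\<bar>)) summable_on UNIV"
    by (rule summable_on_int_if_abs) (use C in \<open>auto simp: h_def\<close>)
  moreover have "norm (f N k) \<le> h (nat \<bar>k\<bar>)" for N k
    using le[of N k] by (simp add: h_def)
  ultimately show ?thesis
    by (rule that)
qed

lemma gauss_dom_summable:
  assumes "0 < r" "r < 1" "c > 0" "gauss_dom r c f"
  shows "f N summable_on UNIV"
proof -
  obtain M where M: "M summable_on UNIV" "\<And>N k. norm (f N k) \<le> M k"
    using gauss_dom_majorant[OF assms] by blast
  show ?thesis
    by (rule abs_summable_summable[OF Infinite_Sum.abs_summable_on_comparison_test'[OF M]])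
qed

text \<open>
  Dominated convergence: the common majorant makes the partial sums converge uniformly in \<open>N\<close>, so
  the two limits may be interchanged.
\<close>

lemma gauss_dom_infsum_tendsto:
  assumes "0 < r" "r < 1" "c > 0" "gauss_dom r c f"
    and lim: "\<And>k. (\<lambda>N. f N k) \<longlonglongrightarrow> g k"
  shows "(\<lambda>N. infsum (f N) UNIV) \<longlonglongrightarrow> infsum g UNIV"
proof -
  obtain M where M: "M summable_on UNIV" "\<And>N k. norm (f N k) \<le> M k"
    using gauss_dom_majorant[OF assms(1-4)] by blast
  have "norm (g k) \<le> M k" for k
    by (rule tendsto_upperbound[OF tendsto_norm[OF lim]]) (use M(2) in auto)
  then have g: "g summable_on UNIV"
    using abs_summable_summable[OF Infinite_Sum.abs_summable_on_comparison_test'[OF M(1)]] by blast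
  show ?thesis
  proof (rule swap_uniform_limit')
    show "(sum g \<longlongrightarrow> infsum g UNIV) (finite_subsets_at_top UNIV)"
      using has_sum_infsum[OF g] by (simp add: has_sum_def)
    show "\<forall>\<^sub>F F in finite_subsets_at_top UNIV. (\<lambda>N. \<Sum>k\<in>F. f N k) \<longlonglongrightarrow> sum g F"
      by (intro tendsto_intros always_eventually allI lim)
    show "uniform_limit UNIV (\<lambda>F N. \<Sum>k\<in>F. f N k) (\<lambda>N. infsum (f N) UNIV)
        (finite_subsets_at_top UNIV)"
      by (rule Weierstrass_m_test_general[OF _ M(1)]) (use M(2) in auto)
  qed auto
qed

text \<open>
  The shift \<open>k \<mapsto> k + 1\<close> permutes the integers, so \<open>R\<close> and its shift have the same sum.
\<close>

lemma has_sum_telescope_int: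
  fixes R :: "int \<Rightarrow> complex"
  assumes "R summable_on UNIV"
  shows "((\<lambda>k. R (k + 1) - R k) has_sum 0) UNIV"
proof -
  have R: "(R has_sum infsum R UNIV) UNIV"
    using assms by simp
  then have "((\<lambda>k. R (k + 1)) has_sum infsum R UNIV) UNIV"
    by (subst has_sum_reindex_bij_witness[of UNIV "\<lambda>k. k - 1" "\<lambda>k. k + 1" UNIV R]) auto
  from has_sum_add[OF this has_sum_uminusI[OF R]] show ?thesis
    by simp
qed

section \<open>A bilateral very-well-poised sum\<close>

lemma gauss_dom_reflect:
  assumes "gauss_dom r c f"
  shows "gauss_dom r c (\<lambda>N k. f N (- k))"
proof -
  obtain C D where 1: "C \<ge> 0" "D \<ge> 1"
    and le: "\<And>N k. norm (f N k) \<le> C * D ^ nat \<bar>k\<bar> * r powr (c * (real_of_int k)\<^sup>2)"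
    using assms unfolding gauss_dom_def by blast
  show ?thesis
  proof (rule gauss_domI[OF 1])
    show "norm (f N (- k)) \<le> C * D ^ nat \<bar>k\<bar> * r powr (c * (real_of_int k)\<^sup>2)" for N k
      using le[of N "- k"] by simp
  qed
qed

text \<open>
  The summand of the very-well-poised \<open>6\<psi>6\<close> series with three of its parameters sent to infinity
  and the remaining one equal to \<open>1 / t\<close>, multiplied by \<open>(1 - A) (A q t, q t; q)\<^sub>\<infinity>\<close> to clear
  all denominators.
\<close>

definition vwp_term :: "complex \<Rightarrow> complex \<Rightarrow> complex \<Rightarrow> int \<Rightarrow> complex" where
  "vwp_term A q t k = (1 - A * q powi (2 * k)) * q powi (k * (2 * k - 1)) * A powi (2 * k)
     * (qpoch_inf (A * t * q * q powi k) q * qpoch_inf (t * q * q powi (- k)) q)"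

text \<open>
  The summand of Sylvester's series, multiplied by \<open>(q; q)\<^sub>\<infinity>\<close> so that \<open>1 / (q; q)\<^sub>k\<close> turns into
  \<open>(q^{k + 1}; q)\<^sub>\<infinity>\<close>. That factor vanishes for \<open>k < 0\<close>, which lets this one-sided series run
  over all integers.
\<close>

definition sylvester_term :: "complex \<Rightarrow> complex \<Rightarrow> int \<Rightarrow> complex" where
  "sylvester_term A q k = (1 - A * q powi (2 * k))
     * (qpoch A q (nat k) * (- A) ^ nat k * q powi (k * (3 * k - 1) div 2))
     * qpoch_inf (q * q powi k) q"

lemma pentagonal_exponent:
  "real_of_int (k * (3 * k - 1) div 2) = 3 / 2 * (real_of_int k)\<^sup>2 + - 1 / 2 * real_of_int k"
proof -
  have "even (k * (3 * k - 1))" by simp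
  then have "real_of_int (k * (3 * k - 1) div 2) = real_of_int (k * (3 * k - 1)) / 2"
    by (simp add: real_of_int_div)
  then show ?thesis by (simp add: field_simps power2_eq_square)
qed

lemma pentagonal_exponent_Suc:
  "(k + 1) * (3 * (k + 1) - 1) div 2 = k * (3 * k - 1) div 2 + (3 * k + 1)" for k :: int
proof -
  have "(k + 1) * (3 * (k + 1) - 1) = k * (3 * k - 1) + (3 * k + 1) * 2"
    by (simp add: algebra_simps)
  then show ?thesis by simp
qed

context
  fixes q :: complex
  assumes q0: "q \<noteq> 0" and q1: "norm q < 1"
begin

lemma gauss_dom_one_minus:
  assumes "\<And>N. norm (A N) \<le> B"
  shows "gauss_dom (norm q) 0 (\<lambda>N k. 1 - A N * q powi (2 * k))"
proof -
  have "gauss_dom (norm q) (0 + 0) (\<lambda>N k. A N * q powi (2 * k))"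
    by (rule gauss_dom_mult[OF gauss_dom_bounded gauss_dom_quadratic_powi[where d = 2]])
       (use q0 q1 assms in auto)
  then have "gauss_dom (norm q) 0 (\<lambda>N k. A N * q powi (2 * k))"
    by simp
  then show ?thesis
    using q0 by (intro gauss_dom_diff[OF gauss_dom_bounded[where B = 1]]) simp_all
qed

lemma gauss_dom_vwp_term:
  assumes "A \<noteq> 0"
  shows "gauss_dom (norm q) 1 (\<lambda>N k. vwp_term A q (t * q ^ N) k)"
proof -
  have tN: "norm (t * q ^ N) \<le> norm t" for N
    using q1 by (simp add: norm_mult norm_power power_le_one mult_left_le)
  have "gauss_dom (norm q) (((0 + 2) + 0) + (- 1 / 2 + - 1 / 2)) (\<lambda>N k. vwp_term A q (t * q ^ N) k)"
    unfolding vwp_term_def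
  proof (intro gauss_dom_mult)
    show "gauss_dom (norm q) 0 (\<lambda>N k. 1 - A * q powi (2 * k))"
      by (rule gauss_dom_one_minus[where B = "norm A"]) simp
    show "gauss_dom (norm q) 2 (\<lambda>N k. q powi (k * (2 * k - 1)))"
      by (rule gauss_dom_quadratic_powi[OF q0 q1, where d = "- 1"])
         (simp add: algebra_simps power2_eq_square)
    show "gauss_dom (norm q) 0 (\<lambda>N k. A powi (2 * k))"
      using gauss_dom_powi[of "norm q" "A\<^sup>2"] assms q0 by (simp add: power_int_mult)
    have "norm (A * (t * q ^ N) * q) \<le> norm A * norm t * norm q" for N
      using tN[of N] by (simp only: norm_mult) (intro mult_right_mono mult_left_mono; simp)
    then show "gauss_dom (norm q) (- 1 / 2) (\<lambda>N k. qpoch_inf (A * (t * q ^ N) * q * q powi k) q)"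
      by (rule gauss_dom_qpoch_inf[OF q0 q1])
    have "norm (t * q ^ N * q) \<le> norm t * norm q" for N
      using tN[of N] by (simp only: norm_mult) (intro mult_right_mono mult_left_mono; simp)
    then show "gauss_dom (norm q) (- 1 / 2) (\<lambda>N k. qpoch_inf (t * q ^ N * q * q powi (- k)) q)"
      by (intro gauss_dom_reflect[where f = "\<lambda>N k. qpoch_inf (t * q ^ N * q * q powi k) q"]
          gauss_dom_qpoch_inf[OF q0 q1])
  qed
  then show ?thesis by simp
qed

lemma vwp_term_summable:
  assumes "A \<noteq> 0"
  shows "vwp_term A q t summable_on UNIV"
  using gauss_dom_summable[OF _ q1 _ gauss_dom_vwp_term[OF assms, of t], of 0] q0 by simp

text \<open>
  The difference of the summands at \<open>t\<close> and \<open>t q\<close> is \<open>R (k + 1) - R k\<close> for the explicit \<open>R\<close> in the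
  proof. It is found by noting that all four terms share the factors
  \<open>(A t q^{k + 2}, t q^{2 - k}; q)\<^sub>\<infinity>\<close>; comparing powers of \<open>t\<close> in the remaining polynomial
  identity determines the coefficient.
\<close>

lemma infsum_vwp_term_shift:
  assumes "A \<noteq> 0"
  shows "infsum (vwp_term A q t) UNIV = infsum (vwp_term A q (t * q)) UNIV"
proof -
  define R where "R k = t * q * q powi (- k) * q powi (k * (2 * k - 1)) * A powi (2 * k)
      * (qpoch_inf (A * t * q * q powi k) q * qpoch_inf (t * q\<^sup>2 * q powi (- k)) q)" for k :: int
  have "gauss_dom (norm q) (((0 + 0) + 2) + 0 + (- 1 / 2 + - 1 / 2)) (\<lambda>N. R)"
    unfolding R_def
  proof (intro gauss_dom_mult)
    show "gauss_dom (norm q) 0 (\<lambda>N k. t * q)"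
      using q0 by (intro gauss_dom_bounded[where B = "norm (t * q)"]) auto
    show "gauss_dom (norm q) 0 (\<lambda>N k. q powi (- k))"
      by (rule gauss_dom_quadratic_powi[OF q0 q1, where d = "- 1"]) simp
    show "gauss_dom (norm q) 2 (\<lambda>N k. q powi (k * (2 * k - 1)))"
      by (rule gauss_dom_quadratic_powi[OF q0 q1, where d = "- 1"])
         (simp add: algebra_simps power2_eq_square)
    show "gauss_dom (norm q) 0 (\<lambda>N k. A powi (2 * k))"
      using gauss_dom_powi[of "norm q" "A\<^sup>2"] assms q0 by (simp add: power_int_mult)
    show "gauss_dom (norm q) (- 1 / 2) (\<lambda>N k. qpoch_inf (A * t * q * q powi k) q)"
      by (rule gauss_dom_qpoch_inf[OF q0 q1 order_refl])
    show "gauss_dom (norm q) (- 1 / 2) (\<lambda>N k. qpoch_inf (t * q\<^sup>2 * q powi (- k)) q)"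
      by (intro gauss_dom_reflect[where f = "\<lambda>N k. qpoch_inf (t * q\<^sup>2 * q powi k) q"]
          gauss_dom_qpoch_inf[OF q0 q1 order_refl])
  qed
  then have R: "R summable_on UNIV"
    using gauss_dom_summable[OF _ q1, of 1 "\<lambda>N. R" 0] q0 by simp
  have cert: "vwp_term A q t k = vwp_term A q (t * q) k + (R (k + 1) - R k)" for k
  proof -
    define K where "K = q powi k"
    define X where "X = qpoch_inf (A * t * q\<^sup>2 * K) q"
    define Y where "Y = qpoch_inf (t * q\<^sup>2 / K) q"
    define s where "s = q powi (k * (2 * k - 1))"
    define B where "B = A powi (2 * k)"
    have K: "K \<noteq> 0" using q0 by (simp add: K_def)
    have K2: "q powi (2 * k) = K\<^sup>2"
      by (simp add: K_def power_int_mult mult.commute[of 2])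
    have Km: "q powi (- k) = 1 / K" "q powi (- (k + 1)) = 1 / (K * q)"
      using q0 by (simp_all add: K_def power_int_minus power_int_add power_int_diff field_simps)
    have s': "q powi ((k + 1) * (2 * (k + 1) - 1)) = s * K ^ 4 * q"
    proof -
      have "(k + 1) * (2 * (k + 1) - 1) = k * (2 * k - 1) + k * 4 + 1"
        by (simp add: algebra_simps)
      then show ?thesis
        using q0 by (simp add: s_def K_def power_int_add power_int_mult)
    qed
    have B': "A powi (2 * (k + 1)) = B * A\<^sup>2"
      using assms by (simp add: B_def power_int_add distrib_left)
    have x: "qpoch_inf (A * t * q * K) q = (1 - A * t * q * K) * X"
      using qpoch_inf_Suc[OF q1, of "A * t * q * K"] by (simp add: X_def power2_eq_square mult_ac)
    have y: "qpoch_inf (t * q * (1 / K)) q = (1 - t * q * (1 / K)) * Y"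
      using qpoch_inf_Suc[OF q1, of "t * q * (1 / K)"] by (simp add: Y_def power2_eq_square mult_ac)
    have x': "qpoch_inf (A * t * q * (K * q)) q = X"
      by (simp add: X_def power2_eq_square mult_ac)
    have x'': "qpoch_inf (A * (t * q) * q * K) q = X"
      by (simp add: X_def power2_eq_square mult_ac)
    have y': "qpoch_inf (t * q\<^sup>2 * (1 / (K * q))) q = (1 - t * q * (1 / K)) * Y"
      using y q0 by (simp add: power2_eq_square mult_ac)
    have y'': "qpoch_inf (t * q * q * (1 / K)) q = Y"
      by (simp add: Y_def power2_eq_square mult_ac)
    have Y3: "qpoch_inf (t * q\<^sup>2 * (1 / K)) q = Y"
      by (simp add: Y_def)
    have K1: "q powi (k + 1) = K * q"
      using q0 by (simp add: K_def power_int_add)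
    define W where "W = s * B * X * Y"
    have 1: "vwp_term A q t k = (1 - A * K\<^sup>2) * ((1 - A * t * q * K) * (1 - t * q * (1 / K))) * W"
      unfolding vwp_term_def K2 Km K_def[symmetric] s_def[symmetric] B_def[symmetric] x y
      by (simp only: W_def mult_ac)
    have 2: "vwp_term A q (t * q) k = (1 - A * K\<^sup>2) * W"
      unfolding vwp_term_def K2 Km K_def[symmetric] s_def[symmetric] B_def[symmetric] x'' y''
      by (simp only: W_def mult_ac)
    have 3: "R k = t * q * (1 / K) * (1 - A * t * q * K) * W"
      unfolding R_def Km K_def[symmetric] s_def[symmetric] B_def[symmetric] x Y3
      by (simp only: W_def mult_ac)
    have "R (k + 1) = t * q * (1 / (K * q)) * (s * K ^ 4 * q) * (B * A\<^sup>2)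
        * (X * ((1 - t * q * (1 / K)) * Y))"
      unfolding R_def Km s' B' K1 x' y' ..
    also have "t * q * (1 / (K * q)) * (s * K ^ 4 * q) = t * q * K ^ 3 * s"
      using K q0 by (simp add: eval_nat_numeral)
    finally have 4: "R (k + 1) = t * q * K ^ 3 * A\<^sup>2 * (1 - t * q * (1 / K)) * W"
      by (simp only: W_def mult_ac)
    have "(1 - A * K\<^sup>2) * ((1 - A * t * q * K) * (1 - t * q * (1 / K)))
        = (1 - A * K\<^sup>2) + (t * q * K ^ 3 * A\<^sup>2 * (1 - t * q * (1 / K))
            - t * q * (1 / K) * (1 - A * t * q * K))"
      using K by (simp add: field_simps) (simp add: algebra_simps eval_nat_numeral)
    then show ?thesis
      unfolding 1 2 3 4 by (simp only: distrib_right left_diff_distrib)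
  qed
  have "((\<lambda>k. vwp_term A q t k) has_sum (infsum (vwp_term A q (t * q)) UNIV + 0)) UNIV"
    unfolding cert
    by (intro has_sum_add has_sum_telescope_int R has_sum_infsum vwp_term_summable assms)
  from infsumI[OF this] show ?thesis
    by simp
qed

text \<open>
  Iterating the shift moves \<open>t\<close> to 0 along \<open>t q^N\<close>, where the sum is continuous.
\<close>

lemma infsum_vwp_term_const:
  assumes "A \<noteq> 0"
  shows "infsum (vwp_term A q t) UNIV = infsum (vwp_term A q 0) UNIV"
proof (rule LIMSEQ_unique)
  have "infsum (vwp_term A q t) UNIV = infsum (vwp_term A q (t * q ^ N)) UNIV" for N
  proof (induction N)
    case (Suc N)
    then show ?case
      using infsum_vwp_term_shift[OF assms, of "t * q ^ N"] by (simp add: mult_ac)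
  qed simp
  then show "(\<lambda>N. infsum (vwp_term A q (t * q ^ N)) UNIV) \<longlonglongrightarrow> infsum (vwp_term A q t) UNIV"
    by simp
  have qN: "(\<lambda>N. q ^ N) \<longlonglongrightarrow> 0"
    using q1 by (intro LIMSEQ_power_zero) auto
  show "(\<lambda>N. infsum (vwp_term A q (t * q ^ N)) UNIV) \<longlonglongrightarrow> infsum (vwp_term A q 0) UNIV"
  proof (rule gauss_dom_infsum_tendsto[OF _ q1 _ gauss_dom_vwp_term[OF assms]])
    fix k
    have 1: "(\<lambda>N. qpoch_inf (A * (t * q ^ N) * q * q powi k) q) \<longlonglongrightarrow> 1"
      by (rule tendsto_qpoch_inf_1[OF q1]) (auto intro!: tendsto_eq_intros qN simp: q1)
    have 2: "(\<lambda>N. qpoch_inf (t * q ^ N * q * q powi (- k)) q) \<longlonglongrightarrow> 1"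
      by (rule tendsto_qpoch_inf_1[OF q1]) (auto intro!: tendsto_eq_intros qN simp: q1)
    have z: "qpoch_inf 0 q = 1"
      using LIMSEQ_unique[OF qpoch_LIMSEQ[OF q1, of 0], of 1] q1 by (simp add: qpoch_def[abs_def])
    show "(\<lambda>N. vwp_term A q (t * q ^ N) k) \<longlonglongrightarrow> vwp_term A q 0 k"
      unfolding vwp_term_def by (auto intro!: tendsto_eq_intros 1 2 simp: z)
  qed (use q0 in auto)
qed

lemma qpoch_inf_powi_eq_0:
  assumes "k \<le> 0"
  shows "qpoch_inf (q powi k) q = 0"
proof (rule qpoch_inf_eq_0[OF q1])
  show "q powi k * q ^ nat (- k) = 1"
    using assms q0 by (simp add: power_int_def flip: power_mult_distrib)
qed

lemma gauss_dom_sylvester_part: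
  "gauss_dom (norm q) (3 / 2) (\<lambda>N k. qpoch (A * q ^ N) q (nat k) * (- (A * q ^ N)) ^ nat k
      * q powi (k * (3 * k - 1) div 2))"
proof -
  have AN: "norm (A * q ^ N) \<le> norm A" for N
    using q1 by (simp add: norm_mult norm_power power_le_one mult_left_le)
  have "gauss_dom (norm q) (0 + 0 + 3 / 2) (\<lambda>N k. qpoch (A * q ^ N) q (nat k)
      * (- (A * q ^ N)) ^ nat k * q powi (k * (3 * k - 1) div 2))"
  proof (intro gauss_dom_mult)
    have "norm (qpoch (A * q ^ N) q (nat k)) \<le> exp (norm A / (1 - norm q))" for N and k :: int
    proof -
      have "norm (qpoch (A * q ^ N) q (nat k)) \<le> exp (norm (A * q ^ N) / (1 - norm q))"
        by (rule norm_qpoch_le[OF q1])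
      also have "\<dots> \<le> exp (norm A / (1 - norm q))"
        using AN[of N] q1 by (simp add: divide_right_mono)
      finally show ?thesis .
    qed
    then show "gauss_dom (norm q) 0 (\<lambda>N k. qpoch (A * q ^ N) q (nat k))"
      using q0 by (intro gauss_dom_bounded) auto
    have "norm ((- (A * q ^ N)) ^ nat k) \<le> 1 * (1 + norm A) ^ nat \<bar>k\<bar>" for N and k :: int
    proof -
      have "norm ((- (A * q ^ N)) ^ nat k) \<le> (1 + norm A) ^ nat k"
        unfolding norm_power using AN[of N] by (intro power_mono) auto
      also have "\<dots> \<le> (1 + norm A) ^ nat \<bar>k\<bar>"
        by (intro power_increasing) auto
      finally show ?thesis by simp
    qed
    then show "gauss_dom (norm q) 0 (\<lambda>N k. (- (A * q ^ N)) ^ nat k)"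
      using q0 by (intro gauss_dom_exponential[where C = 1 and D = "1 + norm A"]) simp_all
    show "gauss_dom (norm q) (3 / 2) (\<lambda>N k. q powi (k * (3 * k - 1) div 2))"
      by (rule gauss_dom_quadratic_powi[OF q0 q1 pentagonal_exponent])
  qed
  then show ?thesis by simp
qed

lemma gauss_dom_sylvester_term: "gauss_dom (norm q) 1 (\<lambda>N. sylvester_term (A * q ^ N) q)"
proof -
  have AN: "norm (A * q ^ N) \<le> norm A" for N
    using q1 by (simp add: norm_mult norm_power power_le_one mult_left_le)
  have "gauss_dom (norm q) (0 + 3 / 2 + - 1 / 2) (\<lambda>N. sylvester_term (A * q ^ N) q)"
    unfolding sylvester_term_def
    by (intro gauss_dom_mult gauss_dom_one_minus[OF AN] gauss_dom_sylvester_part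
        gauss_dom_qpoch_inf[OF q0 q1 order_refl])
  then show ?thesis by simp
qed

text \<open>
  Both \<open>(A; q)\<^sub>k\<close> and \<open>(1 - A) (A q; q)\<^sub>k = (1 - A q^k) (A; q)\<^sub>k\<close> contain \<open>(A; q)\<^sub>k\<close>. Without the
  common factors, the two summands differ by \<open>(1 - q^k) + A q^{3k + 1} (1 - A q^k)\<close>, and the
  two pieces are those of \<open>R k\<close> and \<open>- R (k + 1)\<close>.
\<close>

lemma infsum_sylvester_term_step:
  "infsum (sylvester_term A q) UNIV = (1 - A) * infsum (sylvester_term (A * q) q) UNIV"
proof -
  define R where "R k = qpoch A q (nat k) * (- A) ^ nat k * q powi (k * (3 * k - 1) div 2)
      * qpoch_inf (1 * q powi k) q" for k :: int
  have "gauss_dom (norm q) (3 / 2 + - 1 / 2) (\<lambda>N k. qpoch (A * q ^ N) q (nat k)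
      * (- (A * q ^ N)) ^ nat k * q powi (k * (3 * k - 1) div 2) * qpoch_inf (1 * q powi k) q)"
    by (intro gauss_dom_mult gauss_dom_sylvester_part gauss_dom_qpoch_inf[OF q0 q1 order_refl])
  from gauss_dom_summable[OF _ q1 _ this, of 0] have R: "R summable_on UNIV"
    using q0 by (simp add: R_def[abs_def])
  have S: "sylvester_term A q summable_on UNIV" for A
    using gauss_dom_summable[OF _ q1 _ gauss_dom_sylvester_term, of A 0] q0 by simp
  have cert: "sylvester_term A q k + (R (k + 1) - R k) = (1 - A) * sylvester_term (A * q) q k" for k
  proof (cases "k \<ge> 0")
    case False
    then show ?thesis
      using qpoch_inf_powi_eq_0[of k] qpoch_inf_powi_eq_0[of "k + 1"] q0
      by (simp add: sylvester_term_def R_def power_int_add mult.commute)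
  next
    case True
    then obtain j where j: "k = int j"
      using zero_le_imp_eq_int by blast
    define K where "K = q ^ j"
    define X where "X = qpoch_inf (q * K) q"
    define P where "P = qpoch A q j"
    define s where "s = q powi (k * (3 * k - 1) div 2)"
    have K2: "q powi (2 * k) = K\<^sup>2"
      by (simp add: K_def j power_int_mult mult.commute[of 2])
    have s': "q powi ((k + 1) * (3 * (k + 1) - 1) div 2) = s * (K ^ 3 * q)"
      unfolding pentagonal_exponent_Suc using q0
      by (simp add: s_def K_def j power_int_add power_int_mult mult.commute[of 3])
    have 1: "sylvester_term A q k = (1 - A * K\<^sup>2) * (P * (- A) ^ j * s) * X"
      by (simp add: sylvester_term_def K2 P_def X_def s_def) (simp add: j K_def)
    have P': "(1 - A) * qpoch (A * q) q j = P * (1 - A * K)"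
      unfolding P_def K_def by (metis qpoch_Suc qpoch_Suc_shift)
    have 2: "(1 - A) * sylvester_term (A * q) q k
        = (1 - A * q * K\<^sup>2) * (P * (1 - A * K) * ((- A) ^ j * K) * s) * X"
      by (simp add: sylvester_term_def K2 X_def s_def flip: P')
         (simp add: j K_def power_mult_distrib power_minus[of "A * q"] power_minus[of A])
    have 3: "R k = P * (- A) ^ j * s * ((1 - K) * X)"
      using qpoch_inf_Suc[OF q1, of K]
      by (simp add: R_def s_def) (simp add: j P_def X_def K_def mult.commute)
    have 4: "R (k + 1) = P * (1 - A * K) * ((- A) ^ j * (- A)) * (s * (K ^ 3 * q)) * X"
      unfolding R_def s'
      by (simp add: j nat_add_distrib P_def K_def X_def qpoch_Suc power_int_add q0 mult.commute)
    show ?thesis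
      unfolding 1 2 3 4 by (simp add: algebra_simps power2_eq_square power3_eq_cube)
  qed
  have "((\<lambda>k. sylvester_term A q k + (R (k + 1) - R k)) has_sum
      (infsum (sylvester_term A q) UNIV + 0)) UNIV"
    by (intro has_sum_add has_sum_telescope_int R has_sum_infsum S)
  moreover have "((\<lambda>k. (1 - A) * sylvester_term (A * q) q k) has_sum
      ((1 - A) * infsum (sylvester_term (A * q) q) UNIV)) UNIV"
    by (intro has_sum_cmult_right has_sum_infsum S)
  ultimately show ?thesis
    unfolding cert by (metis add.right_neutral infsumI)
qed

text \<open>
  Iterating the step produces the factor \<open>(A; q)\<^sub>N\<close> and replaces \<open>A\<close> by \<open>A q^N\<close>; in the limit only
  the term \<open>k = 0\<close> survives.
\<close>

lemma infsum_sylvester_term: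
  "infsum (sylvester_term A q) UNIV = qpoch_inf A q * qpoch_inf q q"
proof (rule LIMSEQ_unique)
  have "infsum (sylvester_term A q) UNIV
      = qpoch A q N * infsum (sylvester_term (A * q ^ N) q) UNIV" for N
  proof (induction N)
    case (Suc N)
    then show ?case
      by (simp add: infsum_sylvester_term_step[of "A * q ^ N"] qpoch_Suc mult_ac)
  qed simp
  then show "(\<lambda>N. qpoch A q N * infsum (sylvester_term (A * q ^ N) q) UNIV)
      \<longlonglongrightarrow> infsum (sylvester_term A q) UNIV"
    by simp
  define g where "g k = (if k = 0 then qpoch_inf q q else 0)" for k :: int
  have AN: "(\<lambda>N. A * q ^ N) \<longlonglongrightarrow> 0"
    using q1 by (auto intro!: tendsto_eq_intros LIMSEQ_power_zero)
  have lim: "(\<lambda>N. infsum (sylvester_term (A * q ^ N) q) UNIV) \<longlonglongrightarrow> infsum g UNIV"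
  proof (rule gauss_dom_infsum_tendsto[OF _ q1 _ gauss_dom_sylvester_term])
    fix k :: int
    \<comment> \<open>For \<open>k > 0\<close> the factor \<open>(- A q^N)^k\<close> tends to 0; for \<open>k < 0\<close> every term is 0.\<close>
    consider "k < 0" | "k = 0" | "k > 0" by linarith
    then show "(\<lambda>N. sylvester_term (A * q ^ N) q k) \<longlonglongrightarrow> g k"
    proof cases
      case 1
      then show ?thesis
        using qpoch_inf_powi_eq_0[of "k + 1"] q0
        by (simp add: sylvester_term_def g_def power_int_add mult.commute)
    next
      case 2
      have "(\<lambda>N. (1 - A * q ^ N) * qpoch_inf q q) \<longlonglongrightarrow> (1 - 0) * qpoch_inf q q"
        by (intro tendsto_intros AN)
      with 2 show ?thesis
        by (simp add: sylvester_term_def g_def)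
    next
      case 3
      have "(\<lambda>N. (1 - A * q ^ N * q powi (2 * k))
          * ((\<Prod>j<nat k. 1 - A * q ^ N * q ^ j) * (- (A * q ^ N)) ^ nat k * q powi (k * (3 * k - 1) div 2))
          * qpoch_inf (q * q powi k) q)
        \<longlonglongrightarrow> (1 - 0 * q powi (2 * k))
          * ((\<Prod>j<nat k. 1 - 0 * q ^ j) * (- 0) ^ nat k * q powi (k * (3 * k - 1) div 2))
          * qpoch_inf (q * q powi k) q"
        by (intro tendsto_intros AN)
      with 3 show ?thesis
        by (simp add: sylvester_term_def g_def qpoch_def zero_power)
    qed
  qed (use q0 in auto)
  have "infsum g UNIV = qpoch_inf q q"
  proof (rule infsumI)
    have "(g has_sum (sum g {0})) {0}"
      by (rule has_sum_finite) simp
    then show "(g has_sum qpoch_inf q q) UNIV"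
      by (subst (asm) has_sum_cong_neutral[of UNIV "{0}" g g]) (auto simp: g_def)
  qed
  with lim show "(\<lambda>N. qpoch A q N * infsum (sylvester_term (A * q ^ N) q) UNIV)
      \<longlonglongrightarrow> qpoch_inf A q * qpoch_inf q q"
    by (intro tendsto_mult qpoch_LIMSEQ q1) simp
qed

text \<open>
  At \<open>t = 1 / A\<close> the factor \<open>(A t q^{k + 1}; q)\<^sub>\<infinity> = (q^{k + 1}; q)\<^sub>\<infinity>\<close> cuts off the negative indices,
  and reflecting the other infinite product yields \<open>(A; q)\<^sub>k\<close>.
\<close>

lemma vwp_term_one_sided:
  assumes "A \<noteq> 0"
  shows "vwp_term A q (1 / A) k = qpoch_inf (q / A) q * sylvester_term A q k"
proof (cases "k \<ge> 0")
  case False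
  then show ?thesis
    using qpoch_inf_powi_eq_0[of "k + 1"] q0 assms
    by (simp add: sylvester_term_def vwp_term_def power_int_add mult.commute)
next
  case True
  then obtain j where j: "k = int j"
    using zero_le_imp_eq_int by blast
  define e where "e = k * (3 * k - 1) div 2"
  define Q where "Q = qpoch_inf (1 / A * q powi (1 - int j)) q"
  have Q: "qpoch A q j * qpoch_inf (q / A) q = (- A) ^ j * q ^ (j choose 2) * Q"
    using qpoch_inf_reflect[OF q1 q0, of "1 / A" j] assms by (simp add: Q_def)
  have c: "int (j choose 2) = k * (k - 1) div 2"
    by (cases j) (simp_all add: choose_two zdiv_int j algebra_simps)
  obtain u where u: "k * (k - 1) = 2 * u"
    using evenE[of "k * (k - 1)"] by auto
  obtain v where v: "k * (3 * k - 1) = 2 * v"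
    using evenE[of "k * (3 * k - 1)"] by auto
  have "k * (k - 1) + k * (3 * k - 1) = 2 * (k * (2 * k - 1))"
    by (simp add: algebra_simps)
  then have "int (j choose 2) + e = k * (2 * k - 1)"
    unfolding c e_def u v by simp
  then have s: "q ^ (j choose 2) * q powi e = q powi (k * (2 * k - 1))"
    using q0 by (metis power_int_add power_int_of_nat)
  have A2: "(- A) ^ j * (- A) ^ j = A powi (2 * k)"
    unfolding power_mult_distrib[symmetric]
    by (simp add: j power_int_mult power2_eq_square power_mult_distrib)
  have "vwp_term A q (1 / A) k = (1 - A * q powi (2 * k)) * (q ^ (j choose 2) * q powi e)
      * ((- A) ^ j * (- A) ^ j) * (qpoch_inf (q * q powi k) q * Q)"
    unfolding s A2 vwp_term_def Q_def using assms q0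
    by (simp add: j power_int_diff power_int_minus field_simps)
  also have "\<dots> = (1 - A * q powi (2 * k)) * ((- A) ^ j * q ^ (j choose 2) * Q) * ((- A) ^ j * q powi e)
      * qpoch_inf (q * q powi k) q"
    by (simp add: mult_ac)
  also have "\<dots> = qpoch_inf (q / A) q * sylvester_term A q k"
    unfolding Q[symmetric] sylvester_term_def e_def by (simp add: j mult_ac)
  finally show ?thesis .
qed

lemma vwp_term_has_sum:
  assumes "A \<noteq> 0"
  shows "(vwp_term A q t has_sum (qpoch_inf q q * qpoch_inf A q * qpoch_inf (q / A) q)) UNIV"
proof -
  have "infsum (vwp_term A q t) UNIV = infsum (vwp_term A q (1 / A)) UNIV"
    using infsum_vwp_term_const[OF assms] by metis
  also have "\<dots> = qpoch_inf (q / A) q * infsum (sylvester_term A q) UNIV"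
    unfolding vwp_term_one_sided[OF assms] by (rule infsum_cmult_right')
  also have "\<dots> = qpoch_inf q q * qpoch_inf A q * qpoch_inf (q / A) q"
    by (simp add: infsum_sylvester_term)
  finally show ?thesis
    using has_sum_infsum[OF vwp_term_summable[OF assms, of t]] by simp
qed

end

section \<open>Three-term recurrences\<close>

lemma qpoch_powi_neg_eq_0:
  assumes "p \<noteq> 0" "n < k"
  shows "qpoch (p powi (- int n)) p k = 0"
  unfolding qpoch_eq_0_iff using assms
  by (intro exI[of _ n]) (simp add: power_int_minus)

text \<open>
  Multiplication by \<open>w + 1 / w\<close> sends \<open>\<phi> k = (a w, a / w; p)\<^sub>k\<close> to a combination of \<open>\<phi> k\<close> and
  \<open>\<phi> (k + 1)\<close>, so it is enough to compare coefficients of the \<open>\<phi> k\<close>. The comparison separates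
  by powers of \<open>a\<close>: the part free of \<open>a\<close> is \<open>d_raise\<close>, the part with \<open>a\<^sup>2\<close> is \<open>d_lower\<close>.
\<close>

lemma big_qHermite_recurrence:
  assumes p: "p \<noteq> 0" "\<And>k. k > 0 \<Longrightarrow> p ^ k \<noteq> 1" and a: "a \<noteq> 0" and w: "w \<noteq> 0"
  shows "(w + 1 / w) * big_qHermite n w a p
    = big_qHermite (Suc n) w a p + a * p ^ n * big_qHermite n w a p
      + (1 - p ^ n) * big_qHermite (n - 1) w a p"
proof -
  define \<phi> where "\<phi> k = qpoch (a * w) p k * qpoch (a / w) p k" for k
  define d where "d n k = qpoch (p powi (- int n)) p k / qpoch p p k" for n k
  have pp: "qpoch p p k \<noteq> 0" for k
    using p(2)[of "Suc _"] by (auto simp: qpoch_eq_0_iff)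
  have d0: "d n k = 0" if "n < k" for n k
    using qpoch_powi_neg_eq_0[OF p(1) that] by (simp add: d_def)
  have H: "a ^ n * big_qHermite n w a p = (\<Sum>k\<le>K. d n k * p ^ k * \<phi> k)" if "n \<le> K" for n K
  proof -
    have "(\<Sum>k\<le>K. d n k * p ^ k * \<phi> k) = (\<Sum>k\<le>n. d n k * p ^ k * \<phi> k)"
      using that d0 by (intro sum.mono_neutral_right) auto
    then show ?thesis
      using a by (simp add: big_qHermite_def d_def \<phi>_def power_divide mult_ac)
  qed
  have x\<phi>: "a * (w + 1 / w) * (p ^ k * \<phi> k) = (1 + a\<^sup>2 * (p ^ k)\<^sup>2) * \<phi> k - \<phi> (Suc k)" for k
    using w by (simp add: \<phi>_def qpoch_Suc field_simps power2_eq_square)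
  have d_raise: "d n (Suc k) - d n k = p ^ Suc k * d (Suc n) (Suc k)" for k
  proof -
    define x where "x = p powi (- int n)"
    have x: "p powi (- int (Suc n)) = x / p"
      unfolding x_def power_int_minus power_int_of_nat using p by (simp add: field_simps)
    have ne: "1 - p * p ^ k \<noteq> 0"
      using p(2)[of "Suc k"] by auto
    have "p * qpoch (x / p) p (Suc k) = (p - x) * qpoch x p k"
      using p by (simp add: qpoch_Suc_shift[of "x / p"] field_simps)
    then have f: "p ^ Suc k * qpoch (x / p) p (Suc k) = p ^ k * ((p - x) * qpoch x p k)"
      by (simp only: power_Suc2 mult.assoc)
    show ?thesis
      unfolding d_def x x_def[symmetric] times_divide_eq_right f
      unfolding qpoch_Suc
      using ne pp[of k] by (simp add: divide_simps) (simp add: algebra_simps)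
  qed
  have d_lower: "(p ^ k - p ^ n) * d n k = (1 - p ^ n) * d (n - 1) k" for k
  proof (cases n)
    case 0
    then show ?thesis
      by (cases k) (simp_all add: d0)
  next
    case (Suc n')
    define x where "x = p powi (- int n)"
    have x: "p powi (- int (n - 1)) = x * p" and xn: "x * p ^ n = 1"
      unfolding x_def power_int_minus power_int_of_nat using p by (simp_all add: Suc field_simps)
    have x0: "x \<noteq> 0"
      using xn by auto
    then have pn: "p ^ n = 1 / x"
      using xn by (simp add: field_simps)
    have "qpoch x p k * (1 - x * p ^ k) = (1 - x) * qpoch (x * p) p k"
      by (metis qpoch_Suc qpoch_Suc_shift)
    then have "(p ^ k - p ^ n) * qpoch x p k = (1 - p ^ n) * qpoch (x * p) p k"
      unfolding pn using x0 by (simp add: field_simps)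
    then show ?thesis
      unfolding d_def x x_def[symmetric] by (simp add: divide_simps)
  qed
  have "a ^ Suc n * ((w + 1 / w) * big_qHermite n w a p)
      = a * (w + 1 / w) * (\<Sum>k\<le>n. d n k * p ^ k * \<phi> k)"
    using H[of n n] by (simp add: mult_ac)
  also have "\<dots> = (\<Sum>k\<le>n. d n k * (a * (w + 1 / w) * (p ^ k * \<phi> k)))"
    unfolding sum_distrib_left by (rule sum.cong) (simp_all only: mult_ac)
  also have "\<dots> = (\<Sum>k\<le>n. d n k * \<phi> k) - (\<Sum>k\<le>n. d n k * \<phi> (Suc k))
      + (\<Sum>k\<le>n. a\<^sup>2 * (p ^ k * d n k) * p ^ k * \<phi> k)"
    unfolding x\<phi> by (simp add: algebra_simps sum.distrib sum_subtractf power2_eq_square)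
  also have "(\<Sum>k\<le>n. d n k * \<phi> k) - (\<Sum>k\<le>n. d n k * \<phi> (Suc k))
      = (\<Sum>k\<le>Suc n. d n k * \<phi> k) - (\<Sum>k\<le>n. d n k * \<phi> (Suc k))"
    by (simp add: d0)
  \<comment> \<open>The added term \<open>k = n + 1\<close> is zero; it lets the two sums be combined by a shift.\<close>
  also have "\<dots> = d n 0 * \<phi> 0 + (\<Sum>k\<le>n. (d n (Suc k) - d n k) * \<phi> (Suc k))"
    unfolding sum.atMost_Suc_shift by (simp add: left_diff_distrib sum_subtractf)
  also have "\<dots> = (\<Sum>k\<le>Suc n. d (Suc n) k * p ^ k * \<phi> k)"
    unfolding d_raise sum.atMost_Suc_shift by (simp add: d_def mult_ac)
  also have "(\<Sum>k\<le>n. a\<^sup>2 * (p ^ k * d n k) * p ^ k * \<phi> k)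
      = (\<Sum>k\<le>n. a\<^sup>2 * (p ^ n * d n k + (1 - p ^ n) * d (n - 1) k) * p ^ k * \<phi> k)"
    unfolding d_lower[symmetric] by (simp add: algebra_simps)
  also have "\<dots> = a\<^sup>2 * (p ^ n * (\<Sum>k\<le>n. d n k * p ^ k * \<phi> k)
      + (1 - p ^ n) * (\<Sum>k\<le>n. d (n - 1) k * p ^ k * \<phi> k))"
    by (simp add: sum_distrib_left sum.distrib distrib_left distrib_right mult_ac)
  also have "\<dots> = a\<^sup>2 * (p ^ n * (a ^ n * big_qHermite n w a p)
      + (1 - p ^ n) * (a ^ (n - 1) * big_qHermite (n - 1) w a p))"
    using H[of n n] H[of "n - 1" n] by simp
  also have "(\<Sum>k\<le>Suc n. d (Suc n) k * p ^ k * \<phi> k) = a ^ Suc n * big_qHermite (Suc n) w a p"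
    using H[of "Suc n" "Suc n"] by simp
  also have "a ^ Suc n * big_qHermite (Suc n) w a p + a\<^sup>2 * (p ^ n * (a ^ n * big_qHermite n w a p)
      + (1 - p ^ n) * (a ^ (n - 1) * big_qHermite (n - 1) w a p))
      = a ^ Suc n * (big_qHermite (Suc n) w a p + a * p ^ n * big_qHermite n w a p
        + (1 - p ^ n) * big_qHermite (n - 1) w a p)"
    by (cases n) (simp_all add: algebra_simps power2_eq_square)
  finally show ?thesis
    using a by simp
qed

lemma power_neq_1_if_norm_less_1:
  fixes q :: complex
  assumes "norm q < 1" "k > 0"
  shows "q ^ k \<noteq> 1"
  using assms by (metis less_irrefl norm_one norm_power norm_ge_zero power_less_one_iff)

text \<open>
  The substitution \<open>w = \<i> z\<close>, \<open>a \<mapsto> \<i> a\<close>, \<open>p = 1 / q\<close> turns \<open>w + 1 / w\<close> into \<open>\<i> (z - 1 / z)\<close>, and the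
  normalization \<open>\<i>^{-n}\<close> cancels the powers of \<open>\<i>\<close>, negating only the coefficient of the lower
  neighbour. At \<open>n = 0\<close> that coefficient vanishes, so the truncated index \<open>n - 1\<close> is harmless.
\<close>

lemma big_qinv_Hermite_recurrence:
  assumes q: "q \<noteq> 0" "norm q < 1" and a: "a \<noteq> 0" and z: "z \<noteq> 0"
  shows "(z - 1 / z) * big_qinv_Hermite n z a q
    = big_qinv_Hermite (Suc n) z a q + a / q ^ n * big_qinv_Hermite n z a q
      + (1 / q ^ n - 1) * big_qinv_Hermite (n - 1) z a q"
proof -
  have "(1 / q) ^ k \<noteq> 1" if "k > 0" for k
    using power_neq_1_if_norm_less_1[OF q(2) that] q(1) by (simp add: power_divide field_simps)
  then have rec: "(\<i> * z + 1 / (\<i> * z)) * big_qHermite n (\<i> * z) (\<i> * a) (1 / q)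
    = big_qHermite (Suc n) (\<i> * z) (\<i> * a) (1 / q)
      + \<i> * a * (1 / q) ^ n * big_qHermite n (\<i> * z) (\<i> * a) (1 / q)
      + (1 - (1 / q) ^ n) * big_qHermite (n - 1) (\<i> * z) (\<i> * a) (1 / q)"
    using q a z by (intro big_qHermite_recurrence) auto
  define H where "H n = big_qHermite n (\<i> * z) (\<i> * a) (1 / q)" for n
  have inv: "big_qinv_Hermite n z a q = (1 / \<i>) ^ n * H n" for n
    by (simp only: big_qinv_Hermite_def H_def power_int_minus power_int_of_nat power_one_over
        inverse_eq_divide)
  have "\<i> * z + 1 / (\<i> * z) = \<i> * (z - 1 / z)"
    using z by (simp add: field_simps)
  then have rec': "\<i> * (z - 1 / z) * H n = H (Suc n) + \<i> * a / q ^ n * H n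
      + (1 - 1 / q ^ n) * H (n - 1)"
    using rec unfolding H_def[symmetric] by (simp add: power_divide)
  have "(1 / \<i>) ^ n = (1 / \<i>) ^ Suc n * \<i>"
    by (simp only: power_Suc2 mult.assoc) simp
  then have "(z - 1 / z) * ((1 / \<i>) ^ n * H n) = (1 / \<i>) ^ Suc n * (\<i> * (z - 1 / z) * H n)"
    by (simp only: mult_ac)
  also have "\<dots> = (1 / \<i>) ^ Suc n * H (Suc n) + a / q ^ n * ((1 / \<i>) ^ n * H n)
      + (1 / q ^ n - 1) * ((1 / \<i>) ^ (n - 1) * H (n - 1))"
    unfolding rec' by (cases n) (simp_all add: algebra_simps)
  finally show ?thesis
    unfolding inv .
qed

lemma has_sum_finite_sum:
  fixes f :: "'j \<Rightarrow> 'i \<Rightarrow> complex"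
  assumes "finite J" "\<And>j. j \<in> J \<Longrightarrow> (f j has_sum s j) I"
  shows "((\<lambda>i. \<Sum>j\<in>J. f j i) has_sum (\<Sum>j\<in>J. s j)) I"
  using assms by (induction rule: finite_induct) (auto intro: has_sum_add)

text \<open>
  Eliminating \<open>x\<close> between the recurrences for \<open>P m\<close> and \<open>P n\<close> expresses \<open>P (m + 1) P n\<close> through
  products whose first index is at most \<open>m\<close>. Induction on the first index therefore starts from
  the sums of the single \<open>P n\<close>, and it also delivers the convergence of every series involved.
\<close>

lemma has_sum_orthogonal_three_term:
  fixes W :: "'i \<Rightarrow> complex" and P :: "nat \<Rightarrow> 'i \<Rightarrow> complex"
  assumes rec: "\<And>n i. x i * P n i = P (Suc n) i + \<beta> n * P n i + \<gamma> n * P (n - 1) i"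
    and \<gamma>0: "\<gamma> 0 = 0" and P0: "\<And>i. P 0 i = 1"
    and base: "\<And>n. ((\<lambda>i. W i * P n i) has_sum (if n = 0 then C else 0)) I"
  shows "((\<lambda>i. W i * P m i * P n i) has_sum
    (if m = n then C * (\<Prod>k<n. \<gamma> (Suc k)) else 0)) I"
proof (induction m arbitrary: n rule: less_induct)
  case (less m)
  define V where "V m n = (if m = n then C * (\<Prod>k<n. \<gamma> (Suc k)) else 0)" for m n
  show ?case
  proof (cases m)
    case 0
    then show ?thesis
      using base[of n] by (auto simp: P0)
  next
    case (Suc l)
    have IH: "((\<lambda>i. W i * P j i * P n i) has_sum V j n) I" if "j \<le> l" for j n
      using less.IH[of j n] that unfolding V_def by (simp add: Suc)
    have "((\<lambda>i. W i * P l i * P (Suc n) i + (\<beta> n - \<beta> l) * (W i * P l i * P n i)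
        + \<gamma> n * (W i * P l i * P (n - 1) i) + - \<gamma> l * (W i * P (l - 1) i * P n i)) has_sum
        (V l (Suc n) + (\<beta> n - \<beta> l) * V l n + \<gamma> n * V l (n - 1) + - \<gamma> l * V (l - 1) n)) I"
      by (intro has_sum_add has_sum_cmult_right IH) auto
    also have "V l (Suc n) + (\<beta> n - \<beta> l) * V l n + \<gamma> n * V l (n - 1) + - \<gamma> l * V (l - 1) n = V m n"
      unfolding Suc by (cases n; cases l) (auto simp: V_def \<gamma>0)
    also have "(\<lambda>i. W i * P l i * P (Suc n) i + (\<beta> n - \<beta> l) * (W i * P l i * P n i)
        + \<gamma> n * (W i * P l i * P (n - 1) i) + - \<gamma> l * (W i * P (l - 1) i * P n i))
        = (\<lambda>i. W i * P m i * P n i)"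
    proof
      fix i
      have m: "P m i = x i * P l i - \<beta> l * P l i - \<gamma> l * P (l - 1) i"
        using rec[of i l] by (simp add: Suc)
      have n: "P (Suc n) i = x i * P n i - \<beta> n * P n i - \<gamma> n * P (n - 1) i"
        using rec[of i n] by simp
      show "W i * P l i * P (Suc n) i + (\<beta> n - \<beta> l) * (W i * P l i * P n i)
        + \<gamma> n * (W i * P l i * P (n - 1) i) + - \<gamma> l * (W i * P (l - 1) i * P n i)
        = W i * P m i * P n i"
        unfolding m n by (simp add: algebra_simps)
    qed
    finally show ?thesis
      by (simp add: V_def)
  qed
qed

section \<open>Sums of single polynomials\<close>

text \<open>
  For \<open>b = q^{-n}\<close> and \<open>K = n > 0\<close> the right-hand side contains the factor \<open>1 - b q^n = 0\<close>, which
  is why the polynomials of positive degree sum to zero against the weight.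
\<close>

lemma sum_qpoch_ratio:
  assumes "norm q < 1" "q \<noteq> 0" "b \<noteq> 0"
  shows "(\<Sum>j\<le>K. qpoch b q j / qpoch q q j * (1 / b) ^ j)
    = qpoch (b * q) q K / qpoch q q K * (1 / b) ^ K"
proof (induction K)
  case (Suc K)
  have "qpoch q q K \<noteq> 0" "1 - q * q ^ K \<noteq> 0"
    using power_neq_1_if_norm_less_1[OF assms(1), of "Suc _"] by (auto simp: qpoch_eq_0_iff)
  moreover have "qpoch b q (Suc K) = (1 - b) * qpoch (b * q) q K"
    by (rule qpoch_Suc_shift)
  ultimately show ?case
    unfolding sum.atMost_Suc Suc.IH using assms(3)
    by (simp add: qpoch_Suc[of q] qpoch_Suc[of "b * q"] divide_simps) (simp add: algebra_simps)
qed simp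

context
  fixes q :: complex
  assumes q0: "q \<noteq> 0" and q1: "norm q < 1"
begin

text \<open>
  With \<open>z = q^k \<alpha>\<close>, \<open>t = a / \<alpha>\<close> and \<open>A = - \<alpha>\<^sup>2\<close> the two factors on the left are
  \<open>(z / a; q)\<^sub>j\<close> and \<open>(- 1 / (a z); q)\<^sub>j\<close>. Reflection lets each of them be absorbed by one of the
  infinite products, and the powers of \<open>q^k\<close> produced by the two reflections cancel.
\<close>

lemma vwp_term_mult_qpoch:
  assumes "A \<noteq> 0" "t \<noteq> 0"
  shows "qpoch (q powi k / t) q j * qpoch (1 / (A * t * q powi k)) q j * vwp_term A q t k
    = (1 / (A * t\<^sup>2)) ^ j * q ^ (2 * (j choose 2)) * vwp_term A q (t / q ^ j) k"
proof -
  define y where "y = t * q powi (- k)"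
  define y' where "y' = A * t * q powi k"
  have y: "y \<noteq> 0" "y' \<noteq> 0" "1 / y = q powi k / t"
    using assms q0 by (simp_all add: y_def y'_def power_int_minus field_simps)
  have yy: "(- 1 / y) * (- 1 / y') = 1 / (A * t\<^sup>2)"
    using assms q0 by (simp add: y_def y'_def power_int_minus field_simps power2_eq_square)
  have args: "t * q * q powi (- k) = y * q" "A * t * q * q powi k = y' * q"
    "t / q ^ j * q * q powi (- k) = y * q powi (1 - int j)"
    "A * (t / q ^ j) * q * q powi k = y' * q powi (1 - int j)"
    using q0 by (simp_all add: y_def y'_def power_int_diff)
  have "qpoch (1 / y) q j * qpoch (1 / y') q j * (qpoch_inf (y' * q) q * qpoch_inf (y * q) q)
      = (qpoch (1 / y) q j * qpoch_inf (y * q) q) * (qpoch (1 / y') q j * qpoch_inf (y' * q) q)"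
    by (simp only: mult_ac)
  also have "\<dots> = ((- 1 / y) ^ j * (- 1 / y') ^ j) * q ^ (2 * (j choose 2))
      * (qpoch_inf (y' * q powi (1 - int j)) q * qpoch_inf (y * q powi (1 - int j)) q)"
    unfolding qpoch_inf_reflect[OF q1 q0 y(1)] qpoch_inf_reflect[OF q1 q0 y(2)] mult_2 power_add
    by (simp only: mult_ac)
  finally have "qpoch (1 / y) q j * qpoch (1 / y') q j * (qpoch_inf (y' * q) q * qpoch_inf (y * q) q)
      = (1 / (A * t\<^sup>2)) ^ j * q ^ (2 * (j choose 2))
        * (qpoch_inf (y' * q powi (1 - int j)) q * qpoch_inf (y * q powi (1 - int j)) q)"
    unfolding power_mult_distrib[symmetric] yy .
  from arg_cong[OF this, of "\<lambda>u. (1 - A * q powi (2 * k)) * q powi (k * (2 * k - 1)) * A powi (2 * k) * u"]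
  show ?thesis
    unfolding vwp_term_def args y(3)[symmetric] y'_def[symmetric]
    by (simp only: mult_ac)
qed

text \<open>
  Every basis element contributes the same mass, up to the constant from the previous lemma, since
  the sum of \<open>vwp_term A q t\<close> does not depend on \<open>t\<close>.
\<close>

lemma has_sum_vwp_term_big_qinv_Hermite:
  assumes "\<alpha> \<noteq> 0" "a \<noteq> 0"
  shows "((\<lambda>k. vwp_term (- (\<alpha>\<^sup>2)) q (a / \<alpha>) k * big_qinv_Hermite n (q powi k * \<alpha>) a q) has_sum
    (if n = 0 then qpoch_inf q q * qpoch_inf (- (\<alpha>\<^sup>2)) q * qpoch_inf (- q / \<alpha>\<^sup>2) q else 0)) UNIV"
proof -
  define A where "A = - (\<alpha>\<^sup>2)"
  define t where "t = a / \<alpha>"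
  define C where "C = qpoch_inf q q * qpoch_inf A q * qpoch_inf (q / A) q"
  define c where "c j = (- 1 / a) ^ n * (qpoch (q powi (- int n)) q j / qpoch q q j
    * q powi (- 2 * int (j choose 2)) * (- (q ^ n) * a\<^sup>2) ^ j)" for j
  have At: "A \<noteq> 0" "t \<noteq> 0" "A * t\<^sup>2 = - (a\<^sup>2)"
    using assms by (simp_all add: A_def t_def power_divide)
  have "vwp_term A q t k * big_qinv_Hermite n (q powi k * \<alpha>) a q
      = (\<Sum>j\<le>n. c j * ((1 / (A * t\<^sup>2)) ^ j * q ^ (2 * (j choose 2)) * vwp_term A q (t / q ^ j) k))" for k
  proof -
    have z: "q powi k * \<alpha> / a = q powi k / t" "- 1 / (a * (q powi k * \<alpha>)) = 1 / (A * t * q powi k)"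
      using assms q0 by (simp_all add: A_def t_def field_simps power2_eq_square)
    have nz: "q powi k * \<alpha> \<noteq> 0"
      using assms q0 by simp
    show ?thesis
      unfolding vwp_term_mult_qpoch[OF At(1,2), symmetric]
        big_qinv_Hermite_explicit[OF q0 assms(2) nz] z sum_distrib_left c_def
      by (intro sum.cong) (simp_all only: divide_inverse mult_ac)
  qed
  moreover have "((\<lambda>k. \<Sum>j\<le>n. c j * ((1 / (A * t\<^sup>2)) ^ j * q ^ (2 * (j choose 2)) * vwp_term A q (t / q ^ j) k))
      has_sum (\<Sum>j\<le>n. c j * ((1 / (A * t\<^sup>2)) ^ j * q ^ (2 * (j choose 2)) * C))) UNIV"
    unfolding C_def
    by (intro has_sum_finite_sum has_sum_cmult_right vwp_term_has_sum[OF q0 q1] At) simp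
  moreover have "(\<Sum>j\<le>n. c j * ((1 / (A * t\<^sup>2)) ^ j * q ^ (2 * (j choose 2)) * C)) = (if n = 0 then C else 0)"
  proof -
    define b where "b = q powi (- int n)"
    have b: "b \<noteq> 0" "1 / b = q ^ n"
      using q0 by (simp_all add: b_def power_int_minus divide_inverse)
    have "c j * ((1 / (A * t\<^sup>2)) ^ j * q ^ (2 * (j choose 2)) * C)
        = (- 1 / a) ^ n * C * (qpoch b q j / qpoch q q j * (1 / b) ^ j)" for j
    proof -
      have "(- (q ^ n) * a\<^sup>2) ^ j * (1 / (A * t\<^sup>2)) ^ j = (1 / b) ^ j"
        unfolding power_mult_distrib[symmetric] At(3) b(2) using assms by simp
      moreover have "q powi (- 2 * int (j choose 2)) * q ^ (2 * (j choose 2)) = 1"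
      proof -
        have "- 2 * int (j choose 2) = - int (2 * (j choose 2))" by simp
        then show ?thesis
          unfolding power_int_minus power_int_of_nat using q0 by (simp only: power_int_minus power_int_of_nat) simp
      qed
      ultimately have "(- (q ^ n) * a\<^sup>2) ^ j * (1 / (A * t\<^sup>2)) ^ j
          * (q powi (- 2 * int (j choose 2)) * q ^ (2 * (j choose 2))) = (1 / b) ^ j"
        by simp
      then have "(- 1 / a) ^ n * C * (qpoch b q j / qpoch q q j * (1 / b) ^ j)
        = (- 1 / a) ^ n * C * (qpoch b q j / qpoch q q j * ((- (q ^ n) * a\<^sup>2) ^ j * (1 / (A * t\<^sup>2)) ^ j
          * (q powi (- 2 * int (j choose 2)) * q ^ (2 * (j choose 2)))))"
        by simp
      then show ?thesis
        unfolding c_def b_def[symmetric] by (simp only: mult_ac)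
    qed
    then have "(\<Sum>j\<le>n. c j * ((1 / (A * t\<^sup>2)) ^ j * q ^ (2 * (j choose 2)) * C))
        = (- 1 / a) ^ n * C * (qpoch (b * q) q n / qpoch q q n * (1 / b) ^ n)"
      by (simp only: sum_qpoch_ratio[OF q1 q0 b(1)] flip: sum_distrib_left)
    moreover have "qpoch (b * q) q n = 0" if "n \<noteq> 0"
      unfolding qpoch_eq_0_iff
    proof (intro exI conjI)
      show "n - 1 < n" using that by simp
      have "b * q * q ^ (n - 1) = b * q ^ n"
        using that by (cases n) simp_all
      then show "b * q * q ^ (n - 1) = 1"
        unfolding b(2)[symmetric] using b(1) by simp
    qed
    ultimately show ?thesis
      by (simp add: b_def)
  qed
  moreover have "q / A = - q / \<alpha>\<^sup>2"
    by (simp add: A_def)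
  ultimately show ?thesis
    unfolding C_def A_def[symmetric] t_def[symmetric] by (simp only:)
qed

section \<open>Comparison with the weight\<close>

text \<open>
  For negative \<open>k\<close> the finite product may be zero; then \<open>qpoch_int\<close> takes its default value 0,
  and division by 0 again gives 0, in agreement with the right-hand side.
\<close>

lemma qpoch_inf_divide_qpoch_int:
  assumes "qpoch_inf y q \<noteq> 0"
  shows "qpoch_inf y q / qpoch_int y q k = qpoch_inf (y * q powi k) q"
proof (cases "k \<ge> 0")
  case True
  then show ?thesis
    using qpoch_inf_split[OF q1, of y "nat k"] assms by (auto simp: qpoch_int_def power_int_def)
next
  case False
  have "q powi k * q ^ nat (- k) = 1"
    using False q0 by (simp add: power_int_def flip: power_mult_distrib)
  then have "qpoch_inf (y * q powi k) q = qpoch (y * q powi k) q (nat (- k)) * qpoch_inf y q"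
    using qpoch_inf_split[OF q1, of "y * q powi k" "nat (- k)"] by (simp add: mult.assoc)
  then show ?thesis
    using False by (simp add: qpoch_int_def)
qed

text \<open>
  The nonvanishing of \<open>(q / b; q)\<^sub>\<infinity>\<close> excludes the poles of \<open>(b; q)\<^sub>k\<close> at negative \<open>k\<close>, where the
  identity would fail for the default value 0.
\<close>

lemma qpoch_int_mult_qpoch_inf:
  assumes "b \<noteq> 0" "qpoch_inf (q / b) q \<noteq> 0"
  shows "qpoch_int b q k * qpoch_inf (q / b) q
    = (- b) powi k * q powi (k * (k - 1) div 2) * qpoch_inf (1 / b * q * q powi (- k)) q"
proof (cases "k \<ge> 0")
  case True
  then obtain j where j: "k = int j"
    using zero_le_imp_eq_int by blast
  have "int (j choose 2) = k * (k - 1) div 2"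
    by (cases j) (simp_all add: choose_two zdiv_int j algebra_simps)
  then have "q powi (k * (k - 1) div 2) = q ^ (j choose 2)"
    by (simp flip: power_int_of_nat)
  then show ?thesis
    using qpoch_inf_reflect[OF q1 q0, of "1 / b" j] assms(1) q0
    by (simp add: j qpoch_int_def power_int_diff power_int_minus field_simps)
next
  case False
  define j where "j = nat (- k)"
  have k: "k = - int j"
    using False by (simp add: j_def)
  \<comment> \<open>Reflection is applied at \<open>1 / c = q^j / b\<close>, so that the shift by \<open>q^{1 - j}\<close> ends at \<open>q / b\<close>.\<close>
  define c where "c = b * q powi k"
  have c: "c \<noteq> 0" "1 / c * q = 1 / b * q * q powi (- k)" "1 / c * q powi (1 - int j) = q / b"
    "- 1 / (1 / c) = (- b) * q powi k"
    using assms q0 by (simp_all add: c_def k power_int_minus power_int_diff field_simps)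
  have "qpoch c q j * qpoch_inf (1 / b * q * q powi (- k)) q
      = ((- b) * q powi k) ^ j * q ^ (j choose 2) * qpoch_inf (q / b) q"
    using qpoch_inf_reflect[OF q1 q0, of "1 / c" j] c by simp
  moreover have "((- b) * q powi k) ^ j * q ^ (j choose 2)
      = 1 / ((- b) powi k * q powi (k * (k - 1) div 2))"
  proof -
    have cj: "int (j choose 2) = int j * (int j - 1) div 2"
      by (cases j) (simp_all add: choose_two zdiv_int algebra_simps)
    obtain u where u: "int j * (int j - 1) = 2 * u"
      using evenE[of "int j * (int j - 1)"] by auto
    have "k * (k - 1) = 2 * (int j * int j - u)"
      using u by (simp add: k algebra_simps)
    then have "k * (k - 1) div 2 = int j * int j - int (j choose 2)"
      using u cj by simp
    then have e: "- (k * (k - 1) div 2) = k * int j + int (j choose 2)"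
      by (simp add: k)
    have "q powi (k * int j) * q ^ (j choose 2) = q powi (- (k * (k - 1) div 2))"
      unfolding e using q0 by (simp add: power_int_add)
    moreover have "(- b) ^ j = (- b) powi (- k)"
      by (simp add: k)
    ultimately show ?thesis
      unfolding power_mult_distrib mult.assoc
      by (simp add: power_int_mult power_int_minus divide_inverse)
  qed
  moreover define F where "F = (- b) powi k * q powi (k * (k - 1) div 2)"
  ultimately have "F * (qpoch c q j * qpoch_inf (1 / b * q * q powi (- k)) q)
      = F * (1 / F * qpoch_inf (q / b) q)"
    by (simp only:)
  moreover have "F \<noteq> 0"
    using assms q0 by (simp add: F_def)
  ultimately have e: "qpoch c q j * (F * qpoch_inf (1 / b * q * q powi (- k)) q) = qpoch_inf (q / b) q"
    by (simp add: mult.left_commute)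
  then have "qpoch c q j \<noteq> 0"
    using assms by auto
  with e show ?thesis
    unfolding F_def[symmetric] using False
    by (simp add: qpoch_int_def c_def[symmetric] j_def[symmetric] field_simps)
qed

lemma vwp_term_eq_weight:
  assumes "\<alpha> \<noteq> 0" "a \<noteq> 0" "qpoch_inf (- q * \<alpha> * a) q \<noteq> 0" "qpoch_inf (q * a / \<alpha>) q \<noteq> 0"
  shows "(1 + q powi (2 * k) * \<alpha>\<^sup>2) * (qpoch_int (\<alpha> / a) q k / qpoch_int (- q * \<alpha> * a) q k)
      * q powi (3 * (k * (k - 1) div 2)) * (- q * \<alpha> ^ 3 * a) powi k
    = vwp_term (- (\<alpha>\<^sup>2)) q (a / \<alpha>) k / (qpoch_inf (- q * \<alpha> * a) q * qpoch_inf (q * a / \<alpha>) q)"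
proof -
  define D where "D = qpoch_inf (- q * \<alpha> * a) q"
  define E where "E = qpoch_inf (q * a / \<alpha>) q"
  define T where "T = k * (k - 1) div 2"
  have DE: "D \<noteq> 0" "E \<noteq> 0"
    using assms by (simp_all add: D_def E_def)
  define X where "X = qpoch_inf (- (\<alpha>\<^sup>2) * (a / \<alpha>) * q * q powi k) q"
  define Y where "Y = qpoch_inf (a / \<alpha> * q * q powi (- k)) q"
  have X: "D / qpoch_int (- q * \<alpha> * a) q k = X"
    unfolding D_def X_def using qpoch_inf_divide_qpoch_int[OF assms(3), of k] assms
    by (simp add: power2_eq_square mult_ac)
  have Y: "qpoch_int (\<alpha> / a) q k * E = (- (\<alpha> / a)) powi k * q powi T * Y"
    unfolding E_def Y_def T_def using qpoch_int_mult_qpoch_inf[of "\<alpha> / a" k] assms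
    by (simp add: mult_ac)
  have "2 * T = k * (k - 1)"
    by (simp add: T_def)
  then have T: "k * (2 * k - 1) = T + 3 * T + k"
    by (simp add: algebra_simps)
  have qs: "q powi T * q powi (3 * T) * q powi k = q powi (k * (2 * k - 1))"
    unfolding T by (simp only: power_int_add[OF disjI1[OF q0]])
  have bz: "(- (\<alpha> / a)) * (- q * \<alpha> ^ 3 * a) = q * (- (\<alpha>\<^sup>2))\<^sup>2"
    using assms by (simp add: eval_nat_numeral)
  have as: "(- (\<alpha> / a)) powi k * (- q * \<alpha> ^ 3 * a) powi k = q powi k * (- (\<alpha>\<^sup>2)) powi (2 * k)"
    unfolding power_int_mult_distrib[symmetric] bz
    by (simp only: power_int_mult_distrib power_int_mult power_int_numeral)
  have "((1 + q powi (2 * k) * \<alpha>\<^sup>2) * (qpoch_int (\<alpha> / a) q k / qpoch_int (- q * \<alpha> * a) q k)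
      * q powi (3 * T) * (- q * \<alpha> ^ 3 * a) powi k) * (D * E)
    = (1 + q powi (2 * k) * \<alpha>\<^sup>2) * ((qpoch_int (\<alpha> / a) q k * E) * (D / qpoch_int (- q * \<alpha> * a) q k))
      * q powi (3 * T) * (- q * \<alpha> ^ 3 * a) powi k"
    by (simp add: divide_inverse mult_ac)
  also have "\<dots> = (1 + q powi (2 * k) * \<alpha>\<^sup>2) * (q powi T * q powi (3 * T))
      * ((- (\<alpha> / a)) powi k * (- q * \<alpha> ^ 3 * a) powi k) * (X * Y)"
    unfolding X Y by (simp only: mult_ac)
  also have "\<dots> = (1 + q powi (2 * k) * \<alpha>\<^sup>2) * (q powi T * q powi (3 * T) * q powi k)
      * (- (\<alpha>\<^sup>2)) powi (2 * k) * (X * Y)"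
    unfolding as by (simp only: mult_ac)
  also have "\<dots> = vwp_term (- (\<alpha>\<^sup>2)) q (a / \<alpha>) k"
    unfolding qs vwp_term_def X_def Y_def by (simp add: mult_ac)
  finally show ?thesis
    unfolding D_def[symmetric] E_def[symmetric] T_def[symmetric] using DE by (simp add: field_simps)
qed

end

lemma prod_recurrence_coeffs:
  assumes "q \<noteq> (0::complex)"
  shows "(\<Prod>k<n. 1 / q ^ Suc k - 1) = q powi (- int (n choose 2)) * qpoch q q n / q ^ n"
proof (induction n)
  case (Suc n)
  have "Suc n choose 2 = (n choose 2) + n"
    by (simp add: numeral_2_eq_2)
  then have "q powi (- int (Suc n choose 2)) = q powi (- int (n choose 2)) / q ^ n"
    unfolding power_int_minus power_int_of_nat by (simp add: power_add divide_inverse)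
  moreover have "1 / q ^ Suc n - 1 = (1 - q * q ^ n) / q ^ Suc n"
    using assms by (simp add: field_simps)
  ultimately show ?case
    unfolding prod.lessThan_Suc Suc.IH by (simp add: qpoch_Suc)
qed (simp add: binomial_eq_0)

section \<open>Orthogonality\<close>

theorem theorem3p5:
  fixes m n :: nat and q \<alpha> a :: complex
  assumes "0 < norm q" and "norm q < 1"
    and "\<alpha> \<noteq> 0" and "a \<noteq> 0"
    and "qpoch_inf (- q * \<alpha> * a) q \<noteq> 0"
    and "qpoch_inf (q * a / \<alpha>) q \<noteq> 0"
  shows "((\<lambda>k :: int.
            (1 + q powi (2 * k) * \<alpha>\<^sup>2)
            * big_qinv_Hermite m (q powi k * \<alpha>) a q * big_qinv_Hermite n (q powi k * \<alpha>) a q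
            * (qpoch_int (\<alpha> / a) q k / qpoch_int (- q * \<alpha> * a) q k)
            * q powi (3 * (k * (k - 1) div 2)) * (- q * \<alpha> ^ 3 * a) powi k)
          has_sum
            (qpoch_inf q q * qpoch_inf (- (\<alpha>\<^sup>2)) q * qpoch_inf (- q / \<alpha>\<^sup>2) q
             / (qpoch_inf (- q * \<alpha> * a) q * qpoch_inf (q * a / \<alpha>) q)
             * (q powi (- int (n choose 2)) * qpoch q q n / q ^ n)
             * (if m = n then 1 else 0))) (UNIV :: int set)"
proof -
  have q0: "q \<noteq> 0"
    using assms(1) by auto
  note q1 = assms(2)
  define W where "W = vwp_term (- (\<alpha>\<^sup>2)) q (a / \<alpha>)"
  define H where "H n k = big_qinv_Hermite n (q powi k * \<alpha>) a q" for n and k :: int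
  define C where "C = qpoch_inf q q * qpoch_inf (- (\<alpha>\<^sup>2)) q * qpoch_inf (- q / \<alpha>\<^sup>2) q"
  define D where "D = qpoch_inf (- q * \<alpha> * a) q * qpoch_inf (q * a / \<alpha>) q"
  have "((\<lambda>k. W k * H m k * H n k) has_sum
      (if m = n then C * (\<Prod>k<n. 1 / q ^ Suc k - 1) else 0)) UNIV"
  proof (rule has_sum_orthogonal_three_term[where \<gamma> = "\<lambda>n. 1 / q ^ n - 1"])
    show "(q powi k * \<alpha> - 1 / (q powi k * \<alpha>)) * H n k
      = H (Suc n) k + a / q ^ n * H n k + (1 / q ^ n - 1) * H (n - 1) k" for n k
      unfolding H_def using assms q0 by (intro big_qinv_Hermite_recurrence) auto
    show "H 0 k = 1" for k
      by (simp add: H_def big_qinv_Hermite_def big_qHermite_def)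
    show "((\<lambda>k. W k * H n k) has_sum (if n = 0 then C else 0)) UNIV" for n
      unfolding W_def H_def C_def by (rule has_sum_vwp_term_big_qinv_Hermite[OF q0 q1 assms(3,4)])
  qed simp
  then have "((\<lambda>k. 1 / D * (W k * H m k * H n k)) has_sum
      (1 / D * (if m = n then C * (\<Prod>k<n. 1 / q ^ Suc k - 1) else 0))) UNIV"
    by (rule has_sum_cmult_right)
  also have "1 / D * (if m = n then C * (\<Prod>k<n. 1 / q ^ Suc k - 1) else 0)
      = C / D * (q powi (- int (n choose 2)) * qpoch q q n / q ^ n) * (if m = n then 1 else 0)"
    unfolding prod_recurrence_coeffs[OF q0] by simp
  also have "(\<lambda>k. 1 / D * (W k * H m k * H n k)) = (\<lambda>k. (1 + q powi (2 * k) * \<alpha>\<^sup>2)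
            * big_qinv_Hermite m (q powi k * \<alpha>) a q * big_qinv_Hermite n (q powi k * \<alpha>) a q
            * (qpoch_int (\<alpha> / a) q k / qpoch_int (- q * \<alpha> * a) q k)
            * q powi (3 * (k * (k - 1) div 2)) * (- q * \<alpha> ^ 3 * a) powi k)"
  proof
    fix k
    have "1 / D * (W k * H m k * H n k) = W k / D * (H m k * H n k)"
      by simp
    then show "1 / D * (W k * H m k * H n k) = (1 + q powi (2 * k) * \<alpha>\<^sup>2)
            * big_qinv_Hermite m (q powi k * \<alpha>) a q * big_qinv_Hermite n (q powi k * \<alpha>) a q
            * (qpoch_int (\<alpha> / a) q k / qpoch_int (- q * \<alpha> * a) q k)
            * q powi (3 * (k * (k - 1) div 2)) * (- q * \<alpha> ^ 3 * a) powi k"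
      unfolding W_def D_def vwp_term_eq_weight[OF q0 q1 assms(3-6), symmetric] H_def
      by (simp only: mult_ac)
  qed
  finally show ?thesis
    unfolding C_def D_def .
qed

end
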